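(* Let $p=p_N$ be a sequence of positive integers such that $0<c_1<N/p<c_2<1$ for some constants $c_1,c_2$ and $p/N\to\lambda\in(1,\infty)$ as $N\to\infty$. Let $X=(X_{ij})$ be an $N\times p$ matrix with i.i.d. standard normal $\mathcal{N}(0,1)$ entries, and let $J=\frac1NXX^T$. Then for all $\beta>0$ sufficiently small, $$\frac1N\log\left(\frac1{2^N}\sum_{\sigma\in\{-1,+1\}^N}\exp\big(\beta\,\sigma^TJ\sigma\big)\right)\longrightarrow\frac{\lambda}{2}\log\left(\frac1{1-2\beta}\right)\qquad\text{in probability as }N\to\infty .$$
   Context: This is the Gaussian Hopfield model. With this normalization the empirical spectral distribution of $J$ converges weakly almost surely to the Marchenko–Pastur law with density $\frac{\sqrt{4\lambda-(x-1-\lambda)^2}}{2\pi x}$ on $\big((1-\sqrt\lambda)^2,(1+\sqrt\lambda)^2\big)$. *)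

theory Defs
  imports "HOL-Probability.Probability"
begin

text \<open>
  The dimensions \<open>N\<close> and \<open>p\<close> vary inside the statement, so vectors are functions on \<open>nat\<close> and
  matrices functions on \<open>nat \<Rightarrow> nat\<close>; row indices are those below \<open>N\<close>, column indices those
  below \<open>p\<close>. Entries outside this range are never read.
\<close>

definition coupling_matrix :: "nat \<Rightarrow> nat \<Rightarrow> (nat \<Rightarrow> nat \<Rightarrow> real) \<Rightarrow> nat \<Rightarrow> nat \<Rightarrow> real" where
  "coupling_matrix N p A i k = (1 / real N) * (\<Sum>j<p. A i j * A k j)"

definition quadratic_form :: "nat \<Rightarrow> (nat \<Rightarrow> nat \<Rightarrow> real) \<Rightarrow> (nat \<Rightarrow> real) \<Rightarrow> real" where
  "quadratic_form N J \<sigma> = (\<Sum>i<N. \<Sum>k<N. \<sigma> i * J i k * \<sigma> k)"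

definition spin_configs :: "nat \<Rightarrow> (nat \<Rightarrow> real) set" where
  "spin_configs N = {..<N} \<rightarrow>\<^sub>E {-1, 1}"

definition free_energy :: "nat \<Rightarrow> real \<Rightarrow> (nat \<Rightarrow> nat \<Rightarrow> real) \<Rightarrow> real" where
  "free_energy N \<beta> J =
     (1 / real N) * ln ((1 / 2 ^ N) * (\<Sum>\<sigma>\<in>spin_configs N. exp (\<beta> * quadratic_form N J \<sigma>)))"

text \<open>
  Convergence in probability to a constant. Since the limit is deterministic, the \<open>N\<close>-th variable
  may live on its own probability space \<open>M N\<close>; a common space is the case of constant \<open>M\<close>.
  Measurability is demanded explicitly because \<^const>\<open>measure\<close> is \<open>0\<close> on non-measurable sets.
\<close>

definition converges_in_probability ::
    "(nat \<Rightarrow> 'a measure) \<Rightarrow> (nat \<Rightarrow> 'a \<Rightarrow> real) \<Rightarrow> real \<Rightarrow> bool" where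
  "converges_in_probability M Y c \<longleftrightarrow>
     (\<forall>\<^sub>F N in sequentially. Y N \<in> borel_measurable (M N)) \<and>
     (\<forall>\<epsilon>>0. (\<lambda>N. measure (M N) {\<omega> \<in> space (M N). \<bar>Y N \<omega> - c\<bar> > \<epsilon>}) \<longlonglongrightarrow> 0)"

definition iid_std_normal_matrix ::
    "'a measure \<Rightarrow> nat \<Rightarrow> nat \<Rightarrow> (nat \<Rightarrow> nat \<Rightarrow> 'a \<Rightarrow> real) \<Rightarrow> bool" where
  "iid_std_normal_matrix M N p X \<longleftrightarrow>
     prob_space.indep_vars M (\<lambda>_. borel) (\<lambda>(i, j). X i j) ({..<N} \<times> {..<p}) \<and>
     (\<forall>i<N. \<forall>j<p. distributed M lborel (X i j) std_normal_density)"

end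

theory Submission
  imports Defs
begin

text \<open>
  For a fixed configuration \<open>\<sigma>\<close> the exponent is \<open>\<beta>\<close> times a sum of \<open>p\<close> squared independent standard
  Gaussians, so the partition function \<open>Z\<close> has mean \<open>c ^ p\<close> with \<open>c = 1 / sqrt (1 - 2 \<beta>)\<close>. For small
  \<open>\<beta>\<close> the second moment of \<open>Z\<close> is at most twice the squared mean, so \<open>Z\<close> is comparable to its mean
  with probability bounded below. Efron--Stein over the columns of \<open>X\<close> shows that \<open>ln Z\<close> has variance
  \<open>O(p)\<close>: removing column \<open>j\<close> divides \<open>Z\<close> by a ratio \<open>R \<ge> 1\<close> of mean \<open>c\<close>, and \<open>(ln R)\<^sup>2 \<le> 2 R\<close>. Both
  facts together confine \<open>ln Z\<close> to within \<open>o(N)\<close> of \<open>p ln c\<close> with probability tending to one.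
\<close>

subsection \<open>The Efron--Stein inequality\<close>

text \<open>For a pair of configurations with inner product w, the contribution to E(Z^2) / (E Z)^2
  is (1 - a w^2 / N^2) to the power -p/2, where a = (2 \<beta> / (1 - 2 \<beta>))^2. Typically w^2
  is of order N, and p is of order N, so the average over pairs stays bounded when a p / N is small.
  The bound obtained is 2, not 1 + o(1), so Chebyshev for \<open>Z\<close> itself gives no
  concentration; this is why ln Z is treated separately, where fluctuations of order sqrt p are
  negligible against N. As ln Z grows quadratically in the Gaussian entries, Lipschitz concentration
  does not apply directly. Deleting a column works because the ratio R averages one-column weights
  under probabilities that do not involve that column. Smallness of \<beta> enters through a p \<le>
  N / 4; since p \<le> N / c1, a threshold of order sqrt c1 suffices. The estimates live on a
  product space whose coordinates are whole columns, and reach the given matrices, each on its own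
  space, by pushing the measure forward.\<close>

lemma (in pair_prob_space)
  fixes u :: "'a \<Rightarrow> 'b \<Rightarrow> real"
  assumes [measurable]: "case_prod u \<in> borel_measurable (M1 \<Otimes>\<^sub>M M2)"
    and int: "integrable (M1 \<Otimes>\<^sub>M M2) (\<lambda>(x, y). (u x y)\<^sup>2)"
  shows square_integrable_sections:
      "AE y in M2. integrable M1 (\<lambda>x. u x y) \<and> integrable M1 (\<lambda>x. (u x y)\<^sup>2)"
    and square_integrable_marginal: "integrable M2 (\<lambda>y. (\<integral>x. u x y \<partial>M1)\<^sup>2)"
    and integral_square_marginal_le:
      "(\<integral>y. (\<integral>x. u x y \<partial>M1)\<^sup>2 \<partial>M2) \<le> (\<integral>(x, y). (u x y)\<^sup>2 \<partial>(M1 \<Otimes>\<^sub>M M2))"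
proof -
  have sec2: "AE y in M2. integrable M1 (\<lambda>x. (u x y)\<^sup>2)"
    using AE_integrable_snd[OF int] .
  show sec: "AE y in M2. integrable M1 (\<lambda>x. u x y) \<and> integrable M1 (\<lambda>x. (u x y)\<^sup>2)"
    using sec2 AE_space
  proof eventually_elim
    case (elim y)
    then have [measurable]: "(\<lambda>x. u x y) \<in> borel_measurable M1" by measurable
    show ?case using elim M1.square_integrable_imp_integrable[of "\<lambda>x. u x y"] by simp
  qed
  \<comment> \<open>Jensen for the square, read off from nonnegativity of the variance in
    \<open>x\<close>.\<close>
  have le: "AE y in M2. (\<integral>x. u x y \<partial>M1)\<^sup>2 \<le> (\<integral>x. (u x y)\<^sup>2 \<partial>M1)"
    using sec
  proof eventually_elim
    case (elim y)
    then show ?case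
      using M1.variance_eq[of "\<lambda>x. u x y"] M1.variance_positive[of "\<lambda>x. u x y"] by simp
  qed
  have int2: "integrable M2 (\<lambda>y. \<integral>x. (u x y)\<^sup>2 \<partial>M1)"
    using integrable_snd[OF int] .
  show marg: "integrable M2 (\<lambda>y. (\<integral>x. u x y \<partial>M1)\<^sup>2)"
  proof (rule Bochner_Integration.integrable_bound[OF int2])
    show "AE y in M2. norm ((\<integral>x. u x y \<partial>M1)\<^sup>2) \<le> norm (\<integral>x. (u x y)\<^sup>2 \<partial>M1)"
      using le by eventually_elim auto
  qed measurable
  show "(\<integral>y. (\<integral>x. u x y \<partial>M1)\<^sup>2 \<partial>M2) \<le> (\<integral>(x, y). (u x y)\<^sup>2 \<partial>(M1 \<Otimes>\<^sub>M M2))"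
    unfolding integral_snd[OF int, symmetric]
    by (rule integral_mono_AE[OF marg int2 le])
qed

text \<open>With \<open>y\<close> fixed, \<open>g\<close> is a constant, and the mean of
  \<open>f\<close> is the constant closest to \<open>f\<close> in L2. The left side is the averaged
  variance in \<open>x\<close>; this is the contribution of one coordinate to Efron--Stein.\<close>

lemma (in pair_prob_space) integral_square_diff_marginal_le:
  fixes f g :: "'a \<Rightarrow> 'b \<Rightarrow> real"
  assumes [measurable]: "case_prod f \<in> borel_measurable (M1 \<Otimes>\<^sub>M M2)"
      "case_prod g \<in> borel_measurable (M1 \<Otimes>\<^sub>M M2)"
    and f: "integrable (M1 \<Otimes>\<^sub>M M2) (\<lambda>(x, y). (f x y)\<^sup>2)"
    and fg: "integrable (M1 \<Otimes>\<^sub>M M2) (\<lambda>(x, y). (f x y - g x y)\<^sup>2)"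
    and g: "\<And>x x' y. g x y = g x' y"
  shows "(\<integral>(x, y). (f x y)\<^sup>2 \<partial>(M1 \<Otimes>\<^sub>M M2)) - (\<integral>y. (\<integral>x. f x y \<partial>M1)\<^sup>2 \<partial>M2)
    \<le> (\<integral>(x, y). (f x y - g x y)\<^sup>2 \<partial>(M1 \<Otimes>\<^sub>M M2))"
proof -
  define k where "k = g undefined"
  have gk: "g x y = k y" for x y unfolding k_def by (rule g)
  have fm: "integrable M2 (\<lambda>y. (\<integral>x. f x y \<partial>M1)\<^sup>2)"
    by (rule square_integrable_marginal[OF _ f]) measurable
  have sec: "AE y in M2. integrable M1 (\<lambda>x. f x y) \<and> integrable M1 (\<lambda>x. (f x y)\<^sup>2)"
    by (rule square_integrable_sections[OF _ f]) measurable
  have le: "AE y in M2. (\<integral>x. (f x y)\<^sup>2 \<partial>M1) - (\<integral>x. f x y \<partial>M1)\<^sup>2 \<le> (\<integral>x. (f x y - g x y)\<^sup>2 \<partial>M1)"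
    using sec
  proof eventually_elim
    case (elim y)
    have "(\<integral>x. (f x y - g x y)\<^sup>2 \<partial>M1) = (\<integral>x. (f x y)\<^sup>2 - 2 * k y * f x y + (k y)\<^sup>2 \<partial>M1)"
      by (simp add: gk power2_diff algebra_simps)
    also have "\<dots> = (\<integral>x. (f x y)\<^sup>2 \<partial>M1) - 2 * k y * (\<integral>x. f x y \<partial>M1) + (k y)\<^sup>2"
      using elim by (simp add: M1.prob_space)
    also have "\<dots> = (\<integral>x. (f x y)\<^sup>2 \<partial>M1) - (\<integral>x. f x y \<partial>M1)\<^sup>2 + ((\<integral>x. f x y \<partial>M1) - k y)\<^sup>2"
      by (simp add: power2_eq_square algebra_simps)
    finally show ?case by simp
  qed
  have "(\<integral>y. (\<integral>x. (f x y)\<^sup>2 \<partial>M1) - (\<integral>x. f x y \<partial>M1)\<^sup>2 \<partial>M2) \<le> (\<integral>y. \<integral>x. (f x y - g x y)\<^sup>2 \<partial>M1 \<partial>M2)"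
    using le by (intro integral_mono_AE Bochner_Integration.integrable_diff fm integrable_snd f fg)
  then show ?thesis
    using fm integrable_snd[OF f] by (simp add: integral_snd[OF f] integral_snd[OF fg])
qed

text \<open>Integrating out a coordinate i splits the variance into the mean conditional variance in
  i, bounded with \<open>g i\<close>, plus the variance of the marginal \<open>F\<close>, bounded by
  induction with the marginals \<open>G j\<close> of \<open>g j\<close>; Jensen shows that passing
  to marginals does not increase the terms. Allowing any \<open>g j\<close> that ignores coordinate
  j, instead of a resampled copy, fits the deletion of a column.\<close>

lemma (in product_prob_space) Efron_Stein:
  fixes f :: "('i \<Rightarrow> 'a) \<Rightarrow> real" and g :: "'i \<Rightarrow> ('i \<Rightarrow> 'a) \<Rightarrow> real"
  assumes "finite J"
    and "f \<in> borel_measurable (PiM J M)" "\<And>j. j \<in> J \<Longrightarrow> g j \<in> borel_measurable (PiM J M)"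
    and "integrable (PiM J M) (\<lambda>\<omega>. (f \<omega>)\<^sup>2)"
    and "\<And>j. j \<in> J \<Longrightarrow> integrable (PiM J M) (\<lambda>\<omega>. (f \<omega> - g j \<omega>)\<^sup>2)"
    and "\<And>j X y. j \<in> J \<Longrightarrow> g j (X(j := y)) = g j X"
  shows "(\<integral>\<omega>. (f \<omega>)\<^sup>2 \<partial>PiM J M) - (\<integral>\<omega>. f \<omega> \<partial>PiM J M)\<^sup>2 \<le> (\<Sum>j\<in>J. \<integral>\<omega>. (f \<omega> - g j \<omega>)\<^sup>2 \<partial>PiM J M)"
  using assms
proof (induction J arbitrary: f g)
  case empty
  show ?case by (simp add: PiM_empty lebesgue_integral_count_space_finite)
next
  case (insert i I)
  interpret MI: prob_space "PiM I M" by (intro prob_space_PiM prob_space)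
  interpret P: pair_prob_space "M i" "PiM I M" ..
  let ?P = "M i \<Otimes>\<^sub>M PiM I M"
  let ?J = "PiM (insert i I) M"
  \<comment> \<open>\<open>T\<close> identifies the pair space with the product over the enlarged
    index set, so statements about pairs and about the product can be exchanged.\<close>
  define T where "T = (\<lambda>(x, X). X(i := x) :: 'i \<Rightarrow> 'a)"
  have T[measurable]: "T \<in> ?P \<rightarrow>\<^sub>M ?J" unfolding T_def by measurable
  have distr: "distr ?P ?J T = ?J"
    unfolding T_def by (rule distr_pair_PiM_eq_PiM) (auto intro: prob_space)
  have int_T: "integrable ?P (\<lambda>z. h (T z)) \<longleftrightarrow> integrable ?J h"
      "(\<integral>z. h (T z) \<partial>?P) = (\<integral>\<omega>. h \<omega> \<partial>?J)"
    if [measurable]: "h \<in> borel_measurable ?J" for h :: "('i \<Rightarrow> 'a) \<Rightarrow> real"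
    using integrable_distr_eq[of T ?P ?J h] integral_distr[of T ?P ?J h] by (simp_all add: distr)
  note [measurable] = insert.prems(1)
  define u where "u x X = f (X(i := x))" for x X
  define v where "v j x X = g j (X(i := x))" for j x X
  have uT: "case_prod u = (\<lambda>z. f (T z))" and vT: "case_prod (v j) = (\<lambda>z. g j (T z))" for j
    by (auto simp: u_def v_def T_def)
  have um[measurable]: "case_prod u \<in> borel_measurable ?P"
    unfolding uT by measurable
  have vm: "case_prod (v j) \<in> borel_measurable ?P" if "j \<in> insert i I" for j
    unfolding vT using insert.prems(2)[OF that] by (rule measurable_compose[OF T])
  have u2: "(\<lambda>(x, y). (u x y)\<^sup>2) = (\<lambda>z. (f (T z))\<^sup>2)"
    and uv2: "(\<lambda>(x, y). (u x y - v j x y)\<^sup>2) = (\<lambda>z. (f (T z) - g j (T z))\<^sup>2)" for j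
    by (auto simp: u_def v_def T_def)
  have iu2: "integrable ?P (\<lambda>(x, y). (u x y)\<^sup>2)"
    unfolding u2 using insert.prems(3) by (subst int_T) auto
  have iuv2: "integrable ?P (\<lambda>(x, y). (u x y - v j x y)\<^sup>2)" if "j \<in> insert i I" for j
    unfolding uv2 using insert.prems(2,4)[OF that] by (subst int_T) auto
  define F where "F X = (\<integral>x. u x X \<partial>M i)" for X
  define G where "G j X = (\<integral>x. v j x X \<partial>M i)" for j X
  have Fm: "F \<in> borel_measurable (PiM I M)" unfolding F_def by measurable
  have Gm: "G j \<in> borel_measurable (PiM I M)" if "j \<in> I" for j
  proof -
    have [measurable]: "case_prod (v j) \<in> borel_measurable ?P" using vm that by auto
    show ?thesis unfolding G_def by measurable
  qed
  have iF2: "integrable (PiM I M) (\<lambda>X. (F X)\<^sup>2)"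
    unfolding F_def by (rule P.square_integrable_marginal[OF um iu2])
  \<comment> \<open>Linearity of the inner integral needs integrable sections, which are known only
    for almost every \<open>X\<close>. Integrability of \<open>v j\<close> comes from writing it as
    u - (u - v), since square integrability is given for \<open>f\<close> and for the
    difference.\<close>
  have FG: "AE X in PiM I M. (F X - G j X)\<^sup>2 = (\<integral>x. u x X - v j x X \<partial>M i)\<^sup>2" if "j \<in> I" for j
  proof -
    have [measurable]: "case_prod (v j) \<in> borel_measurable ?P" using vm that by auto
    have "AE X in PiM I M. integrable (M i) (\<lambda>x. u x X - v j x X)"
      using P.square_integrable_sections[of "\<lambda>x y. u x y - v j x y"] iuv2[of j] that by auto
    moreover have "AE X in PiM I M. integrable (M i) (\<lambda>x. u x X)"
      using P.square_integrable_sections[OF um iu2] by auto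
    ultimately show ?thesis
    proof eventually_elim
      case (elim X)
      have "integrable (M i) (\<lambda>x. u x X - (u x X - v j x X))"
        by (rule Bochner_Integration.integrable_diff[OF elim(2,1)])
      then show ?case using elim unfolding F_def G_def by simp
    qed
  qed
  have iFG: "integrable (PiM I M) (\<lambda>X. (F X - G j X)\<^sup>2)"
    and FG_le: "(\<integral>X. (F X - G j X)\<^sup>2 \<partial>PiM I M) \<le> (\<integral>\<omega>. (f \<omega> - g j \<omega>)\<^sup>2 \<partial>?J)" if j: "j \<in> I" for j
  proof -
    have [measurable]: "case_prod (v j) \<in> borel_measurable ?P" using vm that by auto
    have [measurable]: "F \<in> borel_measurable (PiM I M)" "G j \<in> borel_measurable (PiM I M)"
      using Fm Gm j by auto
    have m: "case_prod (\<lambda>x y. u x y - v j x y) \<in> borel_measurable ?P" by measurable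
    have i: "integrable ?P (\<lambda>(x, y). (u x y - v j x y)\<^sup>2)" using iuv2 j by auto
    have [measurable]: "g j \<in> borel_measurable ?J" using insert.prems(2) j by auto
    show "integrable (PiM I M) (\<lambda>X. (F X - G j X)\<^sup>2)"
      by (subst integrable_cong_AE[OF _ _ FG[OF j]]) (use P.square_integrable_marginal[OF m i] in auto)
    have "(\<integral>X. (F X - G j X)\<^sup>2 \<partial>PiM I M) = (\<integral>X. (\<integral>x. u x X - v j x X \<partial>M i)\<^sup>2 \<partial>PiM I M)"
      by (intro integral_cong_AE FG[OF j]) measurable
    also have "\<dots> \<le> (\<integral>(x, y). (u x y - v j x y)\<^sup>2 \<partial>?P)"
      by (rule P.integral_square_marginal_le[OF m i])
    also have "\<dots> = (\<integral>\<omega>. (f \<omega> - g j \<omega>)\<^sup>2 \<partial>?J)"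
      unfolding uv2 by (rule int_T) measurable
    finally show "(\<integral>X. (F X - G j X)\<^sup>2 \<partial>PiM I M) \<le> (\<integral>\<omega>. (f \<omega> - g j \<omega>)\<^sup>2 \<partial>?J)" .
  qed
  have Gindep: "G j (X(j := y)) = G j X" if "j \<in> I" for j X y
  proof -
    have "i \<noteq> j" using that insert.hyps by auto
    then have "v j x (X(j := y)) = v j x X" for x
      using insert.prems(5)[of j "X(i := x)" y] that unfolding v_def by (metis fun_upd_twist insertI2)
    then show ?thesis unfolding G_def by simp
  qed
  have "(\<integral>X. (F X)\<^sup>2 \<partial>PiM I M) - (\<integral>X. F X \<partial>PiM I M)\<^sup>2 \<le> (\<Sum>j\<in>I. \<integral>X. (F X - G j X)\<^sup>2 \<partial>PiM I M)"
    by (rule insert.IH[OF Fm Gm iF2 iFG Gindep])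
  also have "\<dots> \<le> (\<Sum>j\<in>I. \<integral>\<omega>. (f \<omega> - g j \<omega>)\<^sup>2 \<partial>?J)"
    by (rule sum_mono) (rule FG_le)
  finally have 1: "(\<integral>X. (F X)\<^sup>2 \<partial>PiM I M) - (\<integral>X. F X \<partial>PiM I M)\<^sup>2 \<le> (\<Sum>j\<in>I. \<integral>\<omega>. (f \<omega> - g j \<omega>)\<^sup>2 \<partial>?J)" .
  have "v i x X = v i x' X" for x x' X
    using insert.prems(5)[of i X x] insert.prems(5)[of i X x'] unfolding v_def by (metis insertI1)
  moreover have [measurable]: "g i \<in> borel_measurable ?J" using insert.prems(2) by auto
  ultimately have "(\<integral>(x, y). (u x y)\<^sup>2 \<partial>?P) - (\<integral>y. (F y)\<^sup>2 \<partial>PiM I M) \<le> (\<integral>(x, y). (u x y - v i x y)\<^sup>2 \<partial>?P)"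
    unfolding F_def using P.integral_square_diff_marginal_le[OF um vm[of i] iu2 iuv2[of i]] by blast
  also have "(\<integral>(x, y). (u x y)\<^sup>2 \<partial>?P) = (\<integral>\<omega>. (f \<omega>)\<^sup>2 \<partial>?J)"
    unfolding u2 by (rule int_T) measurable
  also have "(\<integral>(x, y). (u x y - v i x y)\<^sup>2 \<partial>?P) = (\<integral>\<omega>. (f \<omega> - g i \<omega>)\<^sup>2 \<partial>?J)"
    unfolding uv2 by (rule int_T) measurable
  finally have 2: "(\<integral>\<omega>. (f \<omega>)\<^sup>2 \<partial>?J) - (\<integral>y. (F y)\<^sup>2 \<partial>PiM I M) \<le> (\<integral>\<omega>. (f \<omega> - g i \<omega>)\<^sup>2 \<partial>?J)" .
  have "integrable ?P (case_prod u)"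
    using P.square_integrable_imp_integrable[OF um] iu2 by (simp add: case_prod_unfold)
  then have "(\<integral>X. F X \<partial>PiM I M) = (\<integral>z. case_prod u z \<partial>?P)"
    unfolding F_def by (rule P.integral_snd)
  also have "\<dots> = (\<integral>\<omega>. f \<omega> \<partial>?J)"
    unfolding uT by (rule int_T) measurable
  finally have 3: "(\<integral>X. F X \<partial>PiM I M) = (\<integral>\<omega>. f \<omega> \<partial>?J)" .
  show ?case using 1 2 3 insert.hyps by simp
qed

subsection \<open>Variance of the logarithm of an averaged product\<close>

text \<open>The quadratic Taylor bound for exp at \<open>ln x\<close>. It trades the second moment
  of a log-ratio, which has no closed form, for the first moment of the ratio, which does.\<close>

lemma ln_square_le:
  fixes x :: real
  assumes "1 \<le> x"
  shows "(ln x)\<^sup>2 \<le> 2 * x"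
proof -
  have "1 + ln x + (ln x)\<^sup>2 / 2 \<le> x"
    using exp_lower_Taylor_quadratic[of "ln x"] assms by simp
  moreover have "0 \<le> ln x" using assms by simp
  ultimately show ?thesis by linarith
qed

text \<open>Normalizing by \<open>card K\<close> makes the value 1 for empty \<open>J\<close>. The
  set of columns is a parameter so that deleting column j is just passing to
  \<open>J - {j}\<close>.\<close>

definition partition_function :: "'k set \<Rightarrow> ('k \<Rightarrow> 'a \<Rightarrow> real) \<Rightarrow> 'i set \<Rightarrow> ('i \<Rightarrow> 'a) \<Rightarrow> real" where
  "partition_function K h J X = (\<Sum>\<sigma>\<in>K. \<Prod>j\<in>J. h \<sigma> (X j)) / card K"

text \<open>\<open>M\<close> is the law of one column and \<open>h\<close> the weight a column gives
  to a configuration. Weights at least 1 make \<open>Z\<close> increase with the set of columns,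
  hence deletion ratios at least 1; the common mean \<open>c\<close> makes their expectation exactly
  \<open>c\<close>.\<close>

locale factor_model = prob_space M for M :: "'a measure" +
  fixes K :: "'k set" and h :: "'k \<Rightarrow> 'a \<Rightarrow> real" and c :: real
  assumes finite_K: "finite K" and K_nonempty: "K \<noteq> {}"
    and h_measurable [measurable]: "\<And>\<sigma>. h \<sigma> \<in> borel_measurable M"
    and h_ge_1: "\<And>\<sigma> x. 1 \<le> h \<sigma> x"
    and h_integrable: "\<And>\<sigma>. \<sigma> \<in> K \<Longrightarrow> integrable M (h \<sigma>)"
    and h_integral: "\<And>\<sigma>. \<sigma> \<in> K \<Longrightarrow> (\<integral>x. h \<sigma> x \<partial>M) = c"
begin

abbreviation "Z \<equiv> partition_function K h"

sublocale P: product_prob_space "\<lambda>_. M" UNIV ..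

lemma card_K_pos: "0 < real (card K)"
  using finite_K K_nonempty by (simp add: card_gt_0_iff)

lemma measurable_Z [measurable]:
  assumes "I \<subseteq> J"
  shows "Z I \<in> borel_measurable (PiM J (\<lambda>_. M))"
proof -
  have "(\<lambda>X. h \<sigma> (X j)) \<in> borel_measurable (PiM J (\<lambda>_. M))" if "j \<in> I" for \<sigma> j
    using that assms measurable_compose[OF measurable_component_singleton[of j J "\<lambda>_. M"] h_measurable[of \<sigma>]] by auto
  then show ?thesis
    unfolding partition_function_def[abs_def]
    by (intro borel_measurable_divide borel_measurable_sum borel_measurable_prod borel_measurable_const) auto
qed

lemma Z_mono:
  assumes "finite J" "I \<subseteq> J"
  shows "Z I X \<le> Z J X"
proof -
  have "(\<Prod>j\<in>I. h \<sigma> (X j)) \<le> (\<Prod>j\<in>J. h \<sigma> (X j))" for \<sigma>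
    using assms h_ge_1 order_trans[OF zero_le_one h_ge_1] by (intro prod_mono2) auto
  then show ?thesis
    unfolding partition_function_def by (intro divide_right_mono sum_mono) auto
qed

lemma Z_ge_1: "finite J \<Longrightarrow> 1 \<le> Z J X"
  using Z_mono[of J "{}" X] card_K_pos by (simp add: partition_function_def)

lemma integrable_Z: "finite J \<Longrightarrow> integrable (PiM J (\<lambda>_. M)) (Z J)"
  and integral_Z: "finite J \<Longrightarrow> (\<integral>X. Z J X \<partial>PiM J (\<lambda>_. M)) = c ^ card J"
proof -
  assume J: "finite J"
  have i: "integrable (PiM J (\<lambda>_. M)) (\<lambda>X. \<Prod>j\<in>J. h \<sigma> (X j))" if "\<sigma> \<in> K" for \<sigma>
    by (rule P.product_integrable_prod[OF J h_integrable[OF that]])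
  show "integrable (PiM J (\<lambda>_. M)) (Z J)"
    unfolding partition_function_def[abs_def]
    by (intro integrable_divide_zero Bochner_Integration.integrable_sum i)
  have "(\<integral>X. Z J X \<partial>PiM J (\<lambda>_. M)) = (\<Sum>\<sigma>\<in>K. \<integral>X. (\<Prod>j\<in>J. h \<sigma> (X j)) \<partial>PiM J (\<lambda>_. M)) / card K"
    unfolding partition_function_def by (simp add: i)
  also have "\<dots> = (\<Sum>\<sigma>\<in>K. c ^ card J) / card K"
    using P.product_integral_prod[OF J h_integrable] by (simp add: h_integral)
  also have "\<dots> = c ^ card J" using card_K_pos by simp
  finally show "(\<integral>X. Z J X \<partial>PiM J (\<lambda>_. M)) = c ^ card J" .
qed

lemma integral_Z_square:
  assumes J: "finite J"
    and int: "\<And>\<sigma> \<tau>. \<sigma> \<in> K \<Longrightarrow> \<tau> \<in> K \<Longrightarrow> integrable M (\<lambda>x. h \<sigma> x * h \<tau> x)"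
  shows "integrable (PiM J (\<lambda>_. M)) (\<lambda>X. (Z J X)\<^sup>2)"
    and "(\<integral>X. (Z J X)\<^sup>2 \<partial>PiM J (\<lambda>_. M)) =
      (\<Sum>\<sigma>\<in>K. \<Sum>\<tau>\<in>K. (\<integral>x. h \<sigma> x * h \<tau> x \<partial>M) ^ card J) / (card K)\<^sup>2"
proof -
  have eq: "(Z J X)\<^sup>2 = (\<Sum>\<sigma>\<in>K. \<Sum>\<tau>\<in>K. \<Prod>j\<in>J. h \<sigma> (X j) * h \<tau> (X j)) / (card K)\<^sup>2" for X
    by (simp add: partition_function_def power2_eq_square sum_product prod.distrib)
  have i: "integrable (PiM J (\<lambda>_. M)) (\<lambda>X. \<Prod>j\<in>J. h \<sigma> (X j) * h \<tau> (X j))" if "\<sigma> \<in> K" "\<tau> \<in> K" for \<sigma> \<tau>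
    by (rule P.product_integrable_prod[OF J int[OF that]])
  show "integrable (PiM J (\<lambda>_. M)) (\<lambda>X. (Z J X)\<^sup>2)"
    unfolding eq by (intro integrable_divide_zero Bochner_Integration.integrable_sum i)
  show "(\<integral>X. (Z J X)\<^sup>2 \<partial>PiM J (\<lambda>_. M)) =
      (\<Sum>\<sigma>\<in>K. \<Sum>\<tau>\<in>K. (\<integral>x. h \<sigma> x * h \<tau> x \<partial>M) ^ card J) / (card K)\<^sup>2"
    unfolding eq using i P.product_integral_prod[OF J int] by (simp add: Bochner_Integration.integral_sum)
qed

text \<open>Given the other columns, the ratio is an average of \<open>h \<sigma> y\<close> with
  Gibbs weights free of \<open>y\<close>, and each \<open>h \<sigma>\<close> has mean
  \<open>c\<close>. Working with the nonnegative integral lets Tonelli apply, so integrability of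
  the ratio is a consequence.\<close>

lemma nn_integral_Z_ratio:
  assumes J: "finite J" "i \<in> J"
  shows "(\<integral>\<^sup>+X. ennreal (Z J X / Z (J - {i}) X) \<partial>PiM J (\<lambda>_. M)) = ennreal c"
proof -
  define I where "I = J - {i}"
  have I: "J = insert i I" "i \<notin> I" "finite I" using J by (auto simp: I_def)
  interpret PI: prob_space "PiM I (\<lambda>_. M)" by (intro prob_space_PiM prob_space_axioms)
  have [measurable]: "Z J \<in> borel_measurable (PiM (insert i I) (\<lambda>_. M))"
      "Z I \<in> borel_measurable (PiM (insert i I) (\<lambda>_. M))"
    using I by (auto intro: measurable_Z)
  have inner: "(\<integral>\<^sup>+y. ennreal (Z J (X(i := y)) / Z I (X(i := y))) \<partial>M) = ennreal c" for X
  proof -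
    have ZI: "Z I (X(i := y)) = Z I X" for y
      unfolding partition_function_def using I(2) by (auto intro!: sum.cong prod.cong arg_cong2[where f="(/)"])
    have ZJ: "Z J (X(i := y)) = (\<Sum>\<sigma>\<in>K. h \<sigma> y * (\<Prod>j\<in>I. h \<sigma> (X j))) / card K" for y
    proof -
      have "(\<Prod>j\<in>I. h \<sigma> ((X(i := y)) j)) = (\<Prod>j\<in>I. h \<sigma> (X j))" for \<sigma>
        using I(2) by (intro prod.cong) auto
      then show ?thesis unfolding partition_function_def I(1) using I(2,3) by simp
    qed
    have pos: "0 < Z I X" using Z_ge_1[OF I(3), of X] by simp
    have i: "integrable M (\<lambda>y. h \<sigma> y * (\<Prod>j\<in>I. h \<sigma> (X j)))" if "\<sigma> \<in> K" for \<sigma>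
      using h_integrable[OF that] by simp
    have "(\<integral>y. Z J (X(i := y)) / Z I X \<partial>M) = (\<Sum>\<sigma>\<in>K. c * (\<Prod>j\<in>I. h \<sigma> (X j))) / card K / Z I X"
      unfolding ZJ using i by (simp add: h_integral)
    also have "\<dots> = c"
    proof -
      have "(\<Sum>\<sigma>\<in>K. c * (\<Prod>j\<in>I. h \<sigma> (X j))) / card K = c * Z I X"
        by (simp add: partition_function_def sum_distrib_left[symmetric])
      then show ?thesis using pos by simp
    qed
    finally have "(\<integral>y. Z J (X(i := y)) / Z I X \<partial>M) = c" .
    moreover have "integrable M (\<lambda>y. Z J (X(i := y)) / Z I X)"
      unfolding ZJ using i by (intro integrable_divide_zero Bochner_Integration.integrable_sum) auto
    moreover have "0 \<le> Z J (X(i := y)) / Z I X" for y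
      using pos Z_ge_1[OF J(1), of "X(i := y)"] by simp
    ultimately show ?thesis
      unfolding ZI by (subst nn_integral_eq_integral) auto
  qed
  have "(\<integral>\<^sup>+X. ennreal (Z J X / Z I X) \<partial>PiM (insert i I) (\<lambda>_. M)) =
      (\<integral>\<^sup>+X. (\<integral>\<^sup>+y. ennreal (Z J (X(i := y)) / Z I (X(i := y))) \<partial>M) \<partial>PiM I (\<lambda>_. M))"
    by (rule P.product_nn_integral_insert[OF I(3,2)]) measurable
  also have "\<dots> = ennreal c"
    unfolding inner by (simp add: PI.emeasure_space_1)
  finally show ?thesis unfolding I(1)[symmetric] unfolding I_def .
qed

lemma integrable_ln_Z_square: "finite J \<Longrightarrow> integrable (PiM J (\<lambda>_. M)) (\<lambda>X. (ln (Z J X))\<^sup>2)"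
  by (rule Bochner_Integration.integrable_bound[of _ "\<lambda>X. 2 * Z J X"])
    (auto intro!: integrable_Z AE_I2 ln_square_le order_trans[OF _ abs_ge_self] Z_ge_1)

lemma integrable_ln_Z: "finite J \<Longrightarrow> integrable (PiM J (\<lambda>_. M)) (\<lambda>X. ln (Z J X))"
proof -
  assume J: "finite J"
  interpret PJ: prob_space "PiM J (\<lambda>_. M)" by (intro prob_space_PiM prob_space_axioms)
  show ?thesis
    by (rule PJ.square_integrable_imp_integrable[OF _ integrable_ln_Z_square[OF J]]) measurable
qed

lemma variance_ln_Z_le:
  fixes J :: "'i set"
  assumes J: "finite J"
  shows "(\<integral>X. (ln (Z J X))\<^sup>2 \<partial>PiM J (\<lambda>_. M)) - (\<integral>X. ln (Z J X) \<partial>PiM J (\<lambda>_. M))\<^sup>2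
    \<le> 2 * c * card J"
proof -
  let ?P = "PiM J (\<lambda>_. M)"
  define g where "g j X = ln (Z (J - {j}) X)" for j and X :: "'i \<Rightarrow> 'a"
  have gm: "g j \<in> borel_measurable ?P" if "j \<in> J" for j
    unfolding g_def[abs_def] by (intro borel_measurable_ln measurable_Z) auto
  have step: "integrable ?P (\<lambda>X. (ln (Z J X) - g j X)\<^sup>2) \<and> (\<integral>X. (ln (Z J X) - g j X)\<^sup>2 \<partial>?P) \<le> 2 * c"
    if j: "j \<in> J" for j
  proof -
    have [measurable]: "Z J \<in> borel_measurable ?P" "Z (J - {j}) \<in> borel_measurable ?P" "g j \<in> borel_measurable ?P"
      using gm[OF j] by (auto intro: measurable_Z)
    have ge: "1 \<le> Z J X / Z (J - {j}) X" for X
      using Z_mono[OF J, of "J - {j}" X] Z_ge_1[of "J - {j}" X] J by (auto simp: field_simps)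
    have ptw: "(ln (Z J X) - g j X)\<^sup>2 \<le> 2 * (Z J X / Z (J - {j}) X)" for X
    proof -
      have "ln (Z J X) - g j X = ln (Z J X / Z (J - {j}) X)"
        unfolding g_def using Z_ge_1[OF J, of X] Z_ge_1[of "J - {j}" X] J by (simp add: ln_div)
      then show ?thesis using ln_square_le[OF ge] by simp
    qed
    have c: "0 \<le> c"
    proof -
      obtain \<sigma> where s: "\<sigma> \<in> K" using K_nonempty by auto
      have "0 \<le> (\<integral>x. h \<sigma> x \<partial>M)"
        using order_trans[OF zero_le_one h_ge_1] by (intro integral_nonneg_AE) auto
      then show ?thesis using h_integral[OF s] by simp
    qed
    have iR: "integrable ?P (\<lambda>X. Z J X / Z (J - {j}) X)"
      using nn_integral_Z_ratio[OF J j] ge order_trans[OF zero_le_one ge]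
      by (intro integrableI_nonneg) auto
    have "ennreal (\<integral>X. Z J X / Z (J - {j}) X \<partial>?P) = ennreal c"
      using nn_integral_eq_integral[OF iR] nn_integral_Z_ratio[OF J j] order_trans[OF zero_le_one ge] by auto
    then have R: "(\<integral>X. Z J X / Z (J - {j}) X \<partial>?P) = c"
      using c order_trans[OF zero_le_one ge] by (subst (asm) ennreal_inj) (auto intro!: integral_nonneg_AE)
    have i: "integrable ?P (\<lambda>X. (ln (Z J X) - g j X)\<^sup>2)"
    proof (rule Bochner_Integration.integrable_bound)
      show "integrable ?P (\<lambda>X. 2 * (Z J X / Z (J - {j}) X))"
        by (intro integrable_mult_right iR)
      show "AE X in ?P. norm ((ln (Z J X) - g j X)\<^sup>2) \<le> norm (2 * (Z J X / Z (J - {j}) X))"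
        unfolding real_norm_def abs_power2 by (intro AE_I2 order_trans[OF ptw abs_ge_self])
    qed measurable
    have "(\<integral>X. (ln (Z J X) - g j X)\<^sup>2 \<partial>?P) \<le> (\<integral>X. 2 * (Z J X / Z (J - {j}) X) \<partial>?P)"
      by (intro integral_mono[OF i _ ptw] integrable_mult_right iR)
    also have "\<dots> = 2 * c"
      by (subst integral_mult_right_zero) (simp only: R)
    finally show ?thesis using i by simp
  qed
  have indep: "g j (X(j := y)) = g j X" for j X y
    unfolding g_def partition_function_def by (auto intro!: arg_cong[where f=ln] sum.cong prod.cong arg_cong2[where f="(/)"])
  have "(\<integral>X. (ln (Z J X))\<^sup>2 \<partial>?P) - (\<integral>X. ln (Z J X) \<partial>?P)\<^sup>2 \<le> (\<Sum>j\<in>J. \<integral>X. (ln (Z J X) - g j X)\<^sup>2 \<partial>?P)"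
    using step by (intro P.Efron_Stein[OF J _ gm integrable_ln_Z_square[OF J] _ indep] borel_measurable_ln measurable_Z) auto
  also have "\<dots> \<le> (\<Sum>j\<in>J. 2 * c)"
    using step by (intro sum_mono) auto
  finally show ?thesis by (simp add: mult.commute)
qed

end

subsection \<open>Gaussian and Rademacher exponential moments\<close>

text \<open>Hoeffding's lemma for a fair coin with range of length 2y, used for nonnegative y and
  extended by evenness.\<close>

lemma cosh_le_exp_half_square:
  fixes x :: real
  shows "cosh x \<le> exp (x\<^sup>2 / 2)"
proof -
  have "cosh y \<le> exp (y\<^sup>2 / 2)" if "0 \<le> y" for y :: real
  proof -
    have "1 + 1 / 2 * (exp (2 * y) - 1) = exp y * cosh y"
      unfolding mult_2 exp_add by (simp add: cosh_def exp_minus field_simps)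
    moreover have "- (2 * y) * (1 / 2) + ln (1 + 1 / 2 * (exp (2 * y) - 1)) \<le> (2 * y)\<^sup>2 / 8"
      using Hoeffdings_lemma_aux[of "2 * y" "1 / 2"] that by simp
    ultimately have "ln (cosh y) \<le> y\<^sup>2 / 2"
      by (simp add: ln_mult power2_eq_square)
    then show ?thesis
      by (metis cosh_real_pos exp_le_cancel_iff exp_ln)
  qed
  from this[of "\<bar>x\<bar>"] show ?thesis by (cases "0 \<le> x") auto
qed

lemma std_normal_density_exp:
  "std_normal_density x * exp (l * x) = exp (l\<^sup>2 / 2) * normal_density l 1 x"
proof -
  have "- x\<^sup>2 / 2 + l * x = l\<^sup>2 / 2 + - (x - l)\<^sup>2 / 2"
    by (simp add: power2_diff field_simps)
  then show ?thesis
    by (simp add: normal_density_def exp_add[symmetric])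
qed

text \<open>A quadratic tilt divides the variance by 1 - 2ts^2 and leaves a normal density, so the
  exponential moment is the prefactor.\<close>

lemma normal_density_exp_square:
  assumes "0 < s" "2 * t * s\<^sup>2 < 1"
  shows "normal_density 0 s x * exp (t * x\<^sup>2) =
    1 / sqrt (1 - 2 * t * s\<^sup>2) * normal_density 0 (s / sqrt (1 - 2 * t * s\<^sup>2)) x"
proof -
  define q where "q = 1 - 2 * t * s\<^sup>2"
  have q: "0 < q" using assms by (simp add: q_def)
  have "- x\<^sup>2 / (2 * s\<^sup>2) + t * x\<^sup>2 = - x\<^sup>2 / (2 * (s / sqrt q)\<^sup>2)"
    using q assms(1) by (simp add: power_divide q_def field_simps)
  moreover have "sqrt (2 * pi * (s / sqrt q)\<^sup>2) = sqrt (2 * pi * s\<^sup>2) / sqrt q"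
    using q by (simp add: power_divide real_sqrt_divide)
  ultimately show ?thesis
    unfolding q_def[symmetric] using q assms(1)
    by (simp add: normal_density_def exp_add[symmetric])
qed

lemma (in prob_space)
  assumes D: "distributed M lborel Y (normal_density 0 s)" and s: "0 < s" "2 * t * s\<^sup>2 < 1"
  shows integrable_exp_square_normal: "integrable M (\<lambda>\<omega>. exp (t * (Y \<omega>)\<^sup>2))"
    and expectation_exp_square_normal: "expectation (\<lambda>\<omega>. exp (t * (Y \<omega>)\<^sup>2)) = 1 / sqrt (1 - 2 * t * s\<^sup>2)"
proof -
  have q: "0 < s / sqrt (1 - 2 * t * s\<^sup>2)" using s by simp
  show "integrable M (\<lambda>\<omega>. exp (t * (Y \<omega>)\<^sup>2))"
    by (subst distributed_integrable[OF D, symmetric])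
      (use q s in \<open>auto simp: normal_density_exp_square\<close>)
  show "expectation (\<lambda>\<omega>. exp (t * (Y \<omega>)\<^sup>2)) = 1 / sqrt (1 - 2 * t * s\<^sup>2)"
    by (subst distributed_integral[OF D, symmetric])
      (use q s in \<open>auto simp: normal_density_exp_square\<close>)
qed

text \<open>Signs preserve the centred normal law, so the signed sum is normal with variance
  \<open>card I\<close> whatever the signs. The empty sum is split off because it has no
  density.\<close>

lemma (in prob_space)
  fixes x :: "'i \<Rightarrow> 'a \<Rightarrow> real" and s :: "'i \<Rightarrow> real" and t :: real
  assumes I: "finite I" and ind: "indep_vars (\<lambda>_. borel) x I"
    and D: "\<And>i. i \<in> I \<Longrightarrow> distributed M lborel (x i) std_normal_density"
    and s: "\<And>i. i \<in> I \<Longrightarrow> s i = -1 \<or> s i = 1" and t: "2 * t * card I < 1"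
  shows integrable_exp_square_signed_sum: "integrable M (\<lambda>\<omega>. exp (t * (\<Sum>i\<in>I. s i * x i \<omega>)\<^sup>2))"
    and expectation_exp_square_signed_sum:
      "expectation (\<lambda>\<omega>. exp (t * (\<Sum>i\<in>I. s i * x i \<omega>)\<^sup>2)) = 1 / sqrt (1 - 2 * t * card I)"
proof -
  have "integrable M (\<lambda>\<omega>. exp (t * (\<Sum>i\<in>I. s i * x i \<omega>)\<^sup>2)) \<and>
      expectation (\<lambda>\<omega>. exp (t * (\<Sum>i\<in>I. s i * x i \<omega>)\<^sup>2)) = 1 / sqrt (1 - 2 * t * card I)"
  proof (cases "I = {}")
    case True
    then show ?thesis by (simp add: prob_space)
  next
    case False
    have D': "distributed M lborel (\<lambda>\<omega>. s i * x i \<omega>) (normal_density 0 1)" if "i \<in> I" for i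
      using normal_density_affine[OF D[OF that], of "s i" 0] s[OF that] by auto
    have ind': "indep_vars (\<lambda>_. borel) (\<lambda>i \<omega>. s i * x i \<omega>) I"
      by (rule indep_vars_compose2[OF ind]) auto
    have "distributed M lborel (\<lambda>\<omega>. \<Sum>i\<in>I. s i * x i \<omega>) (normal_density (\<Sum>i\<in>I. 0) (sqrt (\<Sum>i\<in>I. 1\<^sup>2)))"
      by (rule sum_indep_normal[OF I False ind' _ D']) auto
    then have "distributed M lborel (\<lambda>\<omega>. \<Sum>i\<in>I. s i * x i \<omega>) (normal_density 0 (sqrt (card I)))"
      by simp
    from integrable_exp_square_normal[OF this] expectation_exp_square_normal[OF this] show ?thesis
      using False I t by (simp add: card_gt_0_iff prob_space)
  qed
  then show "integrable M (\<lambda>\<omega>. exp (t * (\<Sum>i\<in>I. s i * x i \<omega>)\<^sup>2))"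
    "expectation (\<lambda>\<omega>. exp (t * (\<Sum>i\<in>I. s i * x i \<omega>)\<^sup>2)) = 1 / sqrt (1 - 2 * t * card I)" by auto
qed

text \<open>
  Where two sign vectors agree they contribute to the sum of the two signed sums, elsewhere to their
  difference; the parallelogram law thus reduces the correlated pair to two independent Gaussians.
\<close>
lemma (in prob_space)
  fixes x :: "'i \<Rightarrow> 'a \<Rightarrow> real" and s u :: "'i \<Rightarrow> real" and t :: real
  assumes I: "finite I" and ind: "indep_vars (\<lambda>_. borel) x I"
    and D: "\<And>i. i \<in> I \<Longrightarrow> distributed M lborel (x i) std_normal_density"
    and s: "\<And>i. i \<in> I \<Longrightarrow> s i = -1 \<or> s i = 1" and u: "\<And>i. i \<in> I \<Longrightarrow> u i = -1 \<or> u i = 1"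
    and t: "0 \<le> t" "4 * t * card I < 1"
  shows integrable_exp_square_signed_sum_pair:
      "integrable M (\<lambda>\<omega>. exp (t * (\<Sum>i\<in>I. s i * x i \<omega>)\<^sup>2) * exp (t * (\<Sum>i\<in>I. u i * x i \<omega>)\<^sup>2))"
    and expectation_exp_square_signed_sum_pair:
      "expectation (\<lambda>\<omega>. exp (t * (\<Sum>i\<in>I. s i * x i \<omega>)\<^sup>2) * exp (t * (\<Sum>i\<in>I. u i * x i \<omega>)\<^sup>2)) =
        1 / sqrt ((1 - 2 * t * card I)\<^sup>2 - (2 * t * (\<Sum>i\<in>I. s i * u i))\<^sup>2)"
proof -
  define A where "A = {i\<in>I. s i = u i}"
  define B where "B = {i\<in>I. s i \<noteq> u i}"
  have AB: "A \<inter> B = {}" "A \<union> B = I" "A \<subseteq> I" "B \<subseteq> I" "finite A" "finite B"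
    using I by (auto simp: A_def B_def)
  define U where "U \<omega> = (\<Sum>i\<in>A. s i * x i \<omega>)" for \<omega>
  define V where "V \<omega> = (\<Sum>i\<in>B. s i * x i \<omega>)" for \<omega>
  have split: "sum f I = sum f A + sum f B" for f :: "'i \<Rightarrow> real"
    using sum.union_disjoint[OF AB(5,6,1)] AB(2) by simp
  have uB: "u i = - s i" if "i \<in> B" for i
    using that s[of i] u[of i] by (auto simp: B_def)
  have "(\<Sum>i\<in>A. u i * x i \<omega>) = U \<omega>" for \<omega> unfolding U_def by (rule sum.cong) (auto simp: A_def)
  moreover have "(\<Sum>i\<in>B. u i * x i \<omega>) = - V \<omega>" for \<omega>
    unfolding V_def sum_negf[symmetric] by (rule sum.cong) (auto simp: uB)
  ultimately have eq: "exp (t * (\<Sum>i\<in>I. s i * x i \<omega>)\<^sup>2) * exp (t * (\<Sum>i\<in>I. u i * x i \<omega>)\<^sup>2) =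
      exp (2 * t * (U \<omega>)\<^sup>2) * exp (2 * t * (V \<omega>)\<^sup>2)" for \<omega>
    by (simp add: split exp_add[symmetric] U_def[symmetric] V_def[symmetric])
      (simp add: power2_eq_square algebra_simps)
  have card: "real (card I) = card A + card B"
    using card_Un_disjoint[OF AB(5,6,1)] AB(2) by simp
  \<comment> \<open>The parallelogram law doubles the coefficient, and \<open>A\<close> may be all
    of \<open>I\<close>; hence the premise with 4t in place of 2t.\<close>
  have "2 * (2 * t) * card A \<le> 4 * t * card I" "2 * (2 * t) * card B \<le> 4 * t * card I"
    using t(1) card_mono[OF I AB(3)] card_mono[OF I AB(4)] by (auto intro!: mult_left_mono)
  then have tA: "2 * (2 * t) * card A < 1" and tB: "2 * (2 * t) * card B < 1"
    using t(2) by linarith+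
  have indA: "indep_vars (\<lambda>_. borel) x A" and indB: "indep_vars (\<lambda>_. borel) x B"
    using indep_vars_subset[OF ind] AB by auto
  have U: "integrable M (\<lambda>\<omega>. exp (2 * t * (U \<omega>)\<^sup>2))"
    "expectation (\<lambda>\<omega>. exp (2 * t * (U \<omega>)\<^sup>2)) = 1 / sqrt (1 - 2 * (2 * t) * card A)"
    unfolding U_def
    by (rule integrable_exp_square_signed_sum[OF AB(5) indA _ _ tA]
        expectation_exp_square_signed_sum[OF AB(5) indA _ _ tA]; use AB s D in auto)+
  have V: "integrable M (\<lambda>\<omega>. exp (2 * t * (V \<omega>)\<^sup>2))"
    "expectation (\<lambda>\<omega>. exp (2 * t * (V \<omega>)\<^sup>2)) = 1 / sqrt (1 - 2 * (2 * t) * card B)"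
    unfolding V_def
    by (rule integrable_exp_square_signed_sum[OF AB(6) indB _ _ tB]
        expectation_exp_square_signed_sum[OF AB(6) indB _ _ tB]; use AB s D in auto)+
  have "indep_var borel ((\<lambda>y. exp (2 * t * (\<Sum>i\<in>A. s i * y i)\<^sup>2)) \<circ> (\<lambda>\<omega>. restrict (\<lambda>i. x i \<omega>) A))
      borel ((\<lambda>y. exp (2 * t * (\<Sum>i\<in>B. s i * y i)\<^sup>2)) \<circ> (\<lambda>\<omega>. restrict (\<lambda>i. x i \<omega>) B))"
    by (rule indep_var_compose[OF indep_var_restrict[OF ind AB(1,3,4)]]) measurable
  then have indUV: "indep_var borel (\<lambda>\<omega>. exp (2 * t * (U \<omega>)\<^sup>2)) borel (\<lambda>\<omega>. exp (2 * t * (V \<omega>)\<^sup>2))"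
    by (simp add: o_def U_def V_def)
  show "integrable M (\<lambda>\<omega>. exp (t * (\<Sum>i\<in>I. s i * x i \<omega>)\<^sup>2) * exp (t * (\<Sum>i\<in>I. u i * x i \<omega>)\<^sup>2))"
    unfolding eq by (rule indep_var_integrable[OF indUV U(1) V(1)])
  have "s i * u i = 1" if "i \<in> A" for i using that s[of i] by (auto simp: A_def)
  moreover have "s i * u i = -1" if "i \<in> B" for i using uB[OF that] that s[of i] by (auto simp: B_def)
  ultimately have su: "(\<Sum>i\<in>I. s i * u i) = real (card A) - card B"
    by (simp add: split)
  have "expectation (\<lambda>\<omega>. exp (2 * t * (U \<omega>)\<^sup>2) * exp (2 * t * (V \<omega>)\<^sup>2)) =
      1 / sqrt ((1 - 2 * (2 * t) * card A) * (1 - 2 * (2 * t) * card B))"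
    using indep_var_lebesgue_integral[OF indUV U(1) V(1)] U(2) V(2) by (simp add: real_sqrt_mult)
  \<comment> \<open>The cardinalities of \<open>A\<close> and \<open>B\<close> are half the sum and
    half the difference of \<open>card I\<close> and the inner product, so the product is a
    difference of squares.\<close>
  also have "(1 - 2 * (2 * t) * card A) * (1 - 2 * (2 * t) * card B) =
      (1 - 2 * t * card I)\<^sup>2 - (2 * t * (\<Sum>i\<in>I. s i * u i))\<^sup>2"
    unfolding su card by (simp add: power2_eq_square algebra_simps)
  finally show "expectation (\<lambda>\<omega>. exp (t * (\<Sum>i\<in>I. s i * x i \<omega>)\<^sup>2) * exp (t * (\<Sum>i\<in>I. u i * x i \<omega>)\<^sup>2)) =
        1 / sqrt ((1 - 2 * t * card I)\<^sup>2 - (2 * t * (\<Sum>i\<in>I. s i * u i))\<^sup>2)"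
    unfolding eq .
qed

text \<open>
  The Gaussian linearization \<open>exp (t w\<^sup>2) = E (exp (sqrt (2 t) w g))\<close> makes the sum over sign vectors
  factorize.
\<close>
lemma sum_spin_configs_exp_square_le:
  fixes s :: "nat \<Rightarrow> real" and t :: real
  assumes s: "\<And>i. i < N \<Longrightarrow> s i = -1 \<or> s i = 1" and t: "0 \<le> t" "2 * t * real N < 1"
  shows "(\<Sum>\<tau>\<in>spin_configs N. exp (t * (\<Sum>i<N. s i * \<tau> i)\<^sup>2)) \<le> 2 ^ N / sqrt (1 - 2 * t * N)"
proof -
  let ?w = "\<lambda>\<tau> :: nat \<Rightarrow> real. \<Sum>i<N. s i * \<tau> i"
  define l where "l = sqrt (2 * t)"
  have l2: "l\<^sup>2 = 2 * t" using t by (simp add: l_def)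
  have lin: "(\<integral>g. std_normal_density g * exp (l * w * g) \<partial>lborel) = exp (t * w\<^sup>2)"
    and int: "integrable lborel (\<lambda>g. std_normal_density g * exp (l * w * g))" for w
    unfolding std_normal_density_exp by (auto simp: power_mult_distrib l2)
  have pt: "(\<Sum>\<tau>\<in>spin_configs N. exp (l * ?w \<tau> * g)) \<le> 2 ^ N * exp (t * N * g\<^sup>2)" for g
  proof -
    have "(\<Sum>\<tau>\<in>spin_configs N. exp (l * ?w \<tau> * g)) =
        (\<Sum>\<tau>\<in>{..<N} \<rightarrow>\<^sub>E {-1, 1}. \<Prod>i<N. exp (l * g * s i * \<tau> i))"
      unfolding spin_configs_def
      by (intro sum.cong refl) (simp add: exp_sum[symmetric] sum_distrib_left sum_distrib_right mult_ac)
    also have "\<dots> = (\<Prod>i<N. \<Sum>e\<in>{-1, 1}. exp (l * g * s i * e))"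
      by (rule prod_sum_PiE[symmetric]) auto
    \<comment> \<open>The sign \<open>s i\<close> at most swaps the two summands, so the fixed
      vector \<open>s\<close> drops out.\<close>
    also have "\<dots> = (\<Prod>i<N. 2 * cosh (l * g))"
    proof (rule prod.cong)
      fix i assume "i \<in> {..<N}"
      then show "(\<Sum>e\<in>{-1, 1}. exp (l * g * s i * e)) = 2 * cosh (l * g)"
        using s[of i] by (auto simp: cosh_def)
    qed simp
    also have "\<dots> \<le> (\<Prod>i<N. 2 * exp ((l * g)\<^sup>2 / 2))"
      by (intro prod_mono) (auto intro: cosh_le_exp_half_square)
    also have "\<dots> = 2 ^ N * exp (t * N * g\<^sup>2)"
      by (simp add: power_mult_distrib l2 exp_of_nat_mult[symmetric] mult_ac)
    finally show ?thesis .
  qed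
  have sq: "std_normal_density g * exp (t * N * g\<^sup>2) =
      1 / sqrt (1 - 2 * t * N) * normal_density 0 (1 / sqrt (1 - 2 * t * N)) g" for g
    using normal_density_exp_square[of 1 "t * N" g] t(2) by (simp add: mult.assoc)
  have pos: "0 < 1 / sqrt (1 - 2 * t * N)" using t(2) by simp
  have "(\<Sum>\<tau>\<in>spin_configs N. exp (t * (?w \<tau>)\<^sup>2)) =
      (\<integral>g. (\<Sum>\<tau>\<in>spin_configs N. std_normal_density g * exp (l * ?w \<tau> * g)) \<partial>lborel)"
    by (subst Bochner_Integration.integral_sum) (auto simp: lin intro: int)
  also have "\<dots> \<le> (\<integral>g. 2 ^ N * (std_normal_density g * exp (t * N * g\<^sup>2)) \<partial>lborel)"
  proof (rule integral_mono)
    show "integrable lborel (\<lambda>g. \<Sum>\<tau>\<in>spin_configs N. std_normal_density g * exp (l * ?w \<tau> * g))"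
      by (intro Bochner_Integration.integrable_sum int)
    show "integrable lborel (\<lambda>g. 2 ^ N * (std_normal_density g * exp (t * N * g\<^sup>2)))"
      unfolding sq using pos by auto
    fix g :: real
    show "(\<Sum>\<tau>\<in>spin_configs N. std_normal_density g * exp (l * ?w \<tau> * g)) \<le>
        2 ^ N * (std_normal_density g * exp (t * N * g\<^sup>2))"
      using mult_left_mono[OF pt normal_density_nonneg[of 0 1 g]]
      by (simp add: sum_distrib_left mult_ac)
  qed
  also have "\<dots> = 2 ^ N / sqrt (1 - 2 * t * N)"
    unfolding sq using pos by simp
  finally show ?thesis .
qed

subsection \<open>Concentration from second moments\<close>

text \<open>
  By Paley--Zygmund, \<open>Z\<close> exceeds half its mean with probability at least \<open>1 / (4 C)\<close>; since this
  is more than the Chebyshev bound for \<open>ln Z\<close>, the two events meet, which pins down the mean of \<open>ln Z\<close>.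
\<close>
lemma (in prob_space) ln_concentration:
  fixes Z :: "'a \<Rightarrow> real"
  assumes Z: "integrable M Z" "\<And>\<omega>. 1 \<le> Z \<omega>" and Z2: "integrable M (\<lambda>\<omega>. (Z \<omega>)\<^sup>2)"
    and C: "0 < C" "expectation (\<lambda>\<omega>. (Z \<omega>)\<^sup>2) \<le> C * (expectation Z)\<^sup>2"
    and lnZ: "integrable M (\<lambda>\<omega>. ln (Z \<omega>))" "integrable M (\<lambda>\<omega>. (ln (Z \<omega>))\<^sup>2)"
    and V: "expectation (\<lambda>\<omega>. (ln (Z \<omega>))\<^sup>2) - (expectation (\<lambda>\<omega>. ln (Z \<omega>)))\<^sup>2 \<le> V"
    and t: "0 < t" "4 * C * V < t\<^sup>2"
  shows "prob {\<omega>\<in>space M. \<bar>ln (Z \<omega>) - ln (expectation Z)\<bar> > ln 2 + 2 * t} \<le> V / t\<^sup>2"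
proof -
  have [measurable]: "Z \<in> borel_measurable M" using Z(1) by auto
  define m where "m = expectation Z"
  define \<mu> where "\<mu> = expectation (\<lambda>\<omega>. ln (Z \<omega>))"
  define A where "A = {\<omega>\<in>space M. m / 2 \<le> Z \<omega>}"
  define B where "B = {\<omega>\<in>space M. t \<le> \<bar>ln (Z \<omega>) - \<mu>\<bar>}"
  have [measurable]: "A \<in> events" "B \<in> events" by (auto simp: A_def B_def)
  have m: "1 \<le> m"
    using integral_mono[of M "\<lambda>_. 1" Z] Z by (simp add: m_def prob_space)
  \<comment> \<open>Jensen for ln, via its tangent line at \<open>m\<close>.\<close>
  have "\<mu> \<le> expectation (\<lambda>\<omega>. ln m + (Z \<omega> / m - 1))"
    unfolding \<mu>_def
  proof (rule integral_mono[OF lnZ(1)])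
    show "integrable M (\<lambda>\<omega>. ln m + (Z \<omega> / m - 1))" using Z by simp
    fix \<omega>
    have "ln (Z \<omega> / m) \<le> Z \<omega> / m - 1"
      using Z(2)[of \<omega>] m by (intro ln_le_minus_one) auto
    then show "ln (Z \<omega>) \<le> ln m + (Z \<omega> / m - 1)"
      using Z(2)[of \<omega>] m by (simp add: ln_div)
  qed
  also have "\<dots> = ln m" using Z m by (simp add: prob_space m_def[symmetric])
  finally have upper: "\<mu> \<le> ln m" .
  have "prob B \<le> variance (\<lambda>\<omega>. ln (Z \<omega>)) / t\<^sup>2"
    unfolding B_def \<mu>_def using lnZ t by (intro Chebyshev_inequality) auto
  also have "\<dots> \<le> V / t\<^sup>2"
    using V by (subst variance_eq[OF lnZ]) (auto intro!: divide_right_mono)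
  finally have cheb: "prob B \<le> V / t\<^sup>2" .
  have "1 / (4 * C) \<le> prob A"
  proof -
    \<comment> \<open>In place of Cauchy--Schwarz, AM-GM with parameter \<open>l\<close> bounds Z on
      \<open>A\<close> by l Z^2 / 2 + 1 / (2 l), while Z < m / 2 off \<open>A\<close>. This
      \<open>l\<close> makes the second-moment term at most m / 4, so a quarter of \<open>m\<close>
      is left for \<open>A\<close>.\<close>
    define l where "l = 1 / (2 * C * m)"
    have l: "0 < l" using C m by (simp add: l_def)
    have "m \<le> expectation (\<lambda>\<omega>. m / 2 + (l / 2 * (Z \<omega>)\<^sup>2 + 1 / (2 * l) * indicator A \<omega>))"
      unfolding m_def
    proof (rule integral_mono[OF Z(1)])
      show "integrable M (\<lambda>\<omega>. expectation Z / 2 + (l / 2 * (Z \<omega>)\<^sup>2 + 1 / (2 * l) * indicator A \<omega>))"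
        using Z2 by (auto intro!: integrable_real_mult_indicator simp: less_top[symmetric])
      fix \<omega> assume w: "\<omega> \<in> space M"
      show "Z \<omega> \<le> expectation Z / 2 + (l / 2 * (Z \<omega>)\<^sup>2 + 1 / (2 * l) * indicator A \<omega>)"
      proof (cases "\<omega> \<in> A")
        case True
        have "0 \<le> (l * Z \<omega> - 1)\<^sup>2 / (2 * l)" using l by simp
        also have "\<dots> = l / 2 * (Z \<omega>)\<^sup>2 + 1 / (2 * l) - Z \<omega>"
          using l by (simp add: power2_diff field_simps power2_eq_square)
        finally show ?thesis using True m by (simp add: m_def)
      next
        case False
        then have "Z \<omega> < m / 2" using w by (auto simp: A_def)
        moreover have "0 \<le> l / 2 * (Z \<omega>)\<^sup>2" using l by simp
        ultimately show ?thesis using False by (simp add: m_def)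
      qed
    qed
    also have "\<dots> = m / 2 + (l / 2 * expectation (\<lambda>\<omega>. (Z \<omega>)\<^sup>2) + 1 / (2 * l) * prob A)"
      using Z2 by (simp add: prob_space less_top[symmetric])
    also have "\<dots> \<le> m / 2 + (l / 2 * (C * m\<^sup>2) + 1 / (2 * l) * prob A)"
      using C(2) l by (intro add_mono mult_left_mono) (auto simp: m_def)
    also have "\<dots> = m / 2 + (m / 4 + C * m * prob A)"
      using C m by (simp add: l_def field_simps power2_eq_square)
    finally have "m * (1 / 4) \<le> m * (C * prob A)" by (simp add: field_simps)
    then have "1 / 4 \<le> C * prob A" using m by (subst (asm) mult_le_cancel_left_pos) auto
    then show ?thesis using C by (simp add: field_simps)
  qed
  moreover have "V / t\<^sup>2 < 1 / (4 * C)" using t C by (simp add: field_simps)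
  ultimately have "prob B < prob A" using cheb by linarith
  then have "\<not> A \<subseteq> B" using finite_measure_mono[of A B] by auto
  then obtain w where w: "w \<in> A" "w \<notin> B" by auto
  then have "ln (Z w) - \<mu> < t" "m / 2 \<le> Z w" by (auto simp: A_def B_def)
  moreover have "ln (m / 2) \<le> ln (Z w)" using w m by (subst ln_le_cancel_iff) (auto simp: A_def)
  ultimately have lower: "ln m - ln 2 - t < \<mu>" using m by (simp add: ln_div)
  \<comment> \<open>As ln m - ln 2 - t < \<mu> \<le> ln m, a deviation of ln 2 + 2t from ln m forces
    one of at least t from \<mu>.\<close>
  have "{\<omega>\<in>space M. \<bar>ln (Z \<omega>) - ln (expectation Z)\<bar> > ln 2 + 2 * t} \<subseteq> B"
    using upper lower t(1) unfolding B_def m_def[symmetric] by auto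
  then show ?thesis using finite_measure_mono[of _ B] cheb by (meson \<open>B \<in> events\<close> order_trans)
qed

subsection \<open>The Gaussian spin model\<close>

definition std_normal_column :: "nat \<Rightarrow> (nat \<Rightarrow> real) measure" where
  "std_normal_column N = PiM {..<N} (\<lambda>_. density lborel std_normal_density)"

text \<open>The contribution of a single column \<open>x\<close> to exp(\<beta> \<sigma>^T J
  \<sigma>); the full weight is the product over columns.\<close>

definition spin_factor :: "nat \<Rightarrow> real \<Rightarrow> (nat \<Rightarrow> real) \<Rightarrow> (nat \<Rightarrow> real) \<Rightarrow> real" where
  "spin_factor N \<beta> \<sigma> x = exp (\<beta> / N * (\<Sum>i<N. \<sigma> i * x i)\<^sup>2)"

lemma prob_space_std_normal: "prob_space (density lborel std_normal_density)"
  by (rule prob_space_normal_density) simp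

lemma prob_space_std_normal_column: "prob_space (std_normal_column N)"
  unfolding std_normal_column_def by (intro prob_space_PiM prob_space_std_normal)

lemma sets_std_normal_column: "sets (std_normal_column N) = sets (PiM {..<N} (\<lambda>_. borel))"
  unfolding std_normal_column_def by (intro sets_PiM_cong) auto

lemma distributed_std_normal_column:
  assumes "i < N"
  shows "distributed (std_normal_column N) lborel (\<lambda>x. x i) std_normal_density"
  unfolding distributed_def
proof (intro conjI)
  have "distr (std_normal_column N) (density lborel std_normal_density) (\<lambda>x. x i) = density lborel std_normal_density"
    unfolding std_normal_column_def using assms prob_space_std_normal by (intro distr_PiM_component) auto
  then show "distr (std_normal_column N) lborel (\<lambda>x. x i) = density lborel std_normal_density"
    by (metis distr_cong sets_density)
  show "(\<lambda>x. x i) \<in> std_normal_column N \<rightarrow>\<^sub>M lborel"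
    using assms unfolding measurable_cong_sets[OF sets_std_normal_column refl] by simp
qed simp

lemma indep_vars_std_normal_column:
  "prob_space.indep_vars (std_normal_column N) (\<lambda>_. borel) (\<lambda>i x. x i) {..<N}"
proof (cases "N = 0")
  case True
  interpret prob_space "std_normal_column N" by (rule prob_space_std_normal_column)
  show ?thesis unfolding indep_vars_def indep_sets_def using True by simp
next
  case False
  interpret prob_space "std_normal_column N" by (rule prob_space_std_normal_column)
  have m: "(\<lambda>x. x i) \<in> std_normal_column N \<rightarrow>\<^sub>M borel" if "i \<in> {..<N}" for i
    using distributed_measurable[OF distributed_std_normal_column[of i N]] that by simp
  have "distr (std_normal_column N) borel (\<lambda>x. x i) = density lborel std_normal_density" if "i \<in> {..<N}" for i
    using distributed_distr_eq_density[OF distributed_std_normal_column[of i N]] that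
    by (metis distr_cong sets_lborel lessThan_iff)
  then have 1: "PiM {..<N} (\<lambda>i. distr (std_normal_column N) borel (\<lambda>x. x i)) = std_normal_column N"
    unfolding std_normal_column_def by (intro PiM_cong) auto
  have "distr (std_normal_column N) (PiM {..<N} (\<lambda>_. borel)) (\<lambda>x. \<lambda>i\<in>{..<N}. x i) =
      distr (std_normal_column N) (std_normal_column N) (\<lambda>x. x)"
    by (rule distr_cong[OF refl sets_std_normal_column[symmetric]]) (auto simp: std_normal_column_def space_PiM)
  also have "\<dots> = std_normal_column N" by (simp add: distr_id)
  finally show ?thesis
    using False m 1 by (subst indep_vars_iff_distr_eq_PiM') auto
qed

lemma card_spin_configs: "card (spin_configs N) = 2 ^ N" and finite_spin_configs: "finite (spin_configs N)"
  by (simp_all add: spin_configs_def card_PiE finite_PiE numeral_eq_Suc)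

lemma spin_configs_signs: "\<sigma> \<in> spin_configs N \<Longrightarrow> i < N \<Longrightarrow> \<sigma> i = -1 \<or> \<sigma> i = 1"
  by (auto simp: spin_configs_def PiE_iff)

text \<open>The factor \<open>\<beta> / N\<close> cancels the variance \<open>N\<close> of the
  signed sum, so all configurations share one mean; \<open>0 \<le> \<beta>\<close> gives weights at
  least 1.\<close>

lemma factor_model_spin:
  assumes N: "0 < N" and \<beta>: "0 \<le> \<beta>" "2 * \<beta> < 1"
  shows "factor_model (std_normal_column N) (spin_configs N) (spin_factor N \<beta>) (1 / sqrt (1 - 2 * \<beta>))"
proof -
  interpret prob_space "std_normal_column N" by (rule prob_space_std_normal_column)
  have t: "2 * (\<beta> / real N) * card {..<N} < 1" using N \<beta> by simp
  note D = distributed_std_normal_column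
  show ?thesis
  proof
    show "finite (spin_configs N)" by (rule finite_spin_configs)
    show "spin_configs N \<noteq> {}" using card_spin_configs[of N] by auto
    fix \<sigma>
    have [measurable]: "(\<lambda>x. x i) \<in> std_normal_column N \<rightarrow>\<^sub>M borel" if "i \<in> {..<N}" for i
      using distributed_measurable[OF distributed_std_normal_column[of i N]] that by simp
    show "spin_factor N \<beta> \<sigma> \<in> borel_measurable (std_normal_column N)"
      unfolding spin_factor_def[abs_def] by measurable
    show "1 \<le> spin_factor N \<beta> \<sigma> x" for x
      using \<beta> by (simp add: spin_factor_def)
    assume s: "\<sigma> \<in> spin_configs N"
    show "integrable (std_normal_column N) (spin_factor N \<beta> \<sigma>)"
      unfolding spin_factor_def[abs_def]
      by (rule integrable_exp_square_signed_sum[OF _ indep_vars_std_normal_column D _ t])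
        (use spin_configs_signs[OF s] in auto)
    show "expectation (spin_factor N \<beta> \<sigma>) = 1 / sqrt (1 - 2 * \<beta>)"
      unfolding spin_factor_def
      by (subst expectation_exp_square_signed_sum[OF _ indep_vars_std_normal_column D _ t])
        (use spin_configs_signs[OF s] N in auto)
  qed
qed

section \<open>Second moment of the Gaussian partition function\<close>

text \<open>On this range 2y^2 \<le> y, so ln(1 - y) \<ge> -y - 2y^2 \<ge> -2y. The exponential form
  turns the p-th power of a pair moment into an exponential of the squared inner product.\<close>

lemma inverse_sqrt_one_minus_le_exp:
  fixes y :: real
  assumes "0 \<le> y" "y \<le> 1 / 2"
  shows "1 / sqrt (1 - y) \<le> exp y"
proof -
  have "2 * y\<^sup>2 \<le> y" using assms mult_left_mono[of y "1 / 2" y] by (simp add: power2_eq_square)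
  then have "- (2 * y) \<le> ln (1 - y)" using ln_one_minus_pos_lower_bound[OF assms] by linarith
  then have "exp (- (2 * y)) \<le> 1 - y" using assms by (subst (asm) ln_ge_iff) auto
  then have "sqrt ((exp (- y))\<^sup>2) \<le> sqrt (1 - y)"
    by (intro real_sqrt_le_mono) (simp add: exp_double[symmetric])
  then have "exp (- y) \<le> sqrt (1 - y)" by simp
  then have "1 / sqrt (1 - y) \<le> 1 / exp (- y)" by (intro divide_left_mono) (use assms in auto)
  then show ?thesis by (simp add: exp_minus field_simps)
qed

text \<open>A pair moment is \<open>c\<close> squared over sqrt(1 - y), with y the squared
  normalized inner product times a = (2\<beta> / (1 - 2\<beta>))^2. The bound a \<le> 1/2 keeps y in
  the range of the exponential estimate; a p \<le> N / 4 keeps the resulting sum over configurations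
  at most 2 times their number; 4\<beta> < 1 makes pair moments finite, including the diagonal
  ones.\<close>

lemma spin_second_moment_le:
  fixes N p :: nat and \<beta> :: real
  assumes N: "0 < N" and \<beta>: "0 \<le> \<beta>" "4 * \<beta> < 1"
    and a: "(2 * \<beta> / (1 - 2 * \<beta>))\<^sup>2 \<le> 1 / 2" "(2 * \<beta> / (1 - 2 * \<beta>))\<^sup>2 * p \<le> N / 4"
  shows "integrable (PiM {..<p} (\<lambda>_. std_normal_column N))
      (\<lambda>X. (partition_function (spin_configs N) (spin_factor N \<beta>) {..<p} X)\<^sup>2)"
    and "(\<integral>X. (partition_function (spin_configs N) (spin_factor N \<beta>) {..<p} X)\<^sup>2 \<partial>PiM {..<p} (\<lambda>_. std_normal_column N))
      \<le> 2 * ((1 / sqrt (1 - 2 * \<beta>)) ^ p)\<^sup>2"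
proof -
  let ?K = "spin_configs N" and ?h = "spin_factor N \<beta>" and ?c = "1 / sqrt (1 - 2 * \<beta>)"
  define a where "a = (2 * \<beta> / (1 - 2 * \<beta>))\<^sup>2"
  interpret factor_model "std_normal_column N" ?K ?h ?c
    by (rule factor_model_spin) (use N \<beta> in auto)
  have t: "0 \<le> \<beta> / real N" "4 * (\<beta> / real N) * card {..<N} < 1" using N \<beta> by auto
  define w where "w \<sigma> \<tau> = (\<Sum>i<N. \<sigma> i * \<tau> i)" for \<sigma> \<tau> :: "nat \<Rightarrow> real"
  have pair_int: "integrable (std_normal_column N) (\<lambda>x. ?h \<sigma> x * ?h \<tau> x)"
    and pair: "expectation (\<lambda>x. ?h \<sigma> x * ?h \<tau> x) \<le> ?c\<^sup>2 * exp (a * (w \<sigma> \<tau>)\<^sup>2 / N\<^sup>2)"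
    if s: "\<sigma> \<in> ?K" "\<tau> \<in> ?K" for \<sigma> \<tau>
  proof -
    show "integrable (std_normal_column N) (\<lambda>x. ?h \<sigma> x * ?h \<tau> x)"
      unfolding spin_factor_def
      by (rule integrable_exp_square_signed_sum_pair[OF _ indep_vars_std_normal_column distributed_std_normal_column _ _ t])
        (use spin_configs_signs[OF s(1)] spin_configs_signs[OF s(2)] in auto)
    define y where "y = a * (w \<sigma> \<tau>)\<^sup>2 / N\<^sup>2"
    have "\<bar>w \<sigma> \<tau>\<bar> \<le> (\<Sum>i<N. 1)"
      unfolding w_def
    proof (rule order_trans[OF sum_abs sum_mono])
      fix i assume "i \<in> {..<N}"
      then show "\<bar>\<sigma> i * \<tau> i\<bar> \<le> 1"
        using spin_configs_signs[OF s(1), of i] spin_configs_signs[OF s(2), of i] by auto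
    qed
    then have "(w \<sigma> \<tau>)\<^sup>2 / N\<^sup>2 \<le> 1" using N by (simp add: abs_le_square_iff[symmetric])
    then have "a * ((w \<sigma> \<tau>)\<^sup>2 / N\<^sup>2) \<le> a * 1" by (intro mult_left_mono) (auto simp: a_def)
    then have "y \<le> a" by (simp add: y_def)
    moreover have "0 \<le> y" by (simp add: y_def a_def)
    ultimately have y: "0 \<le> y" "y \<le> 1 / 2" using a(1) unfolding a_def by linarith+
    have "expectation (\<lambda>x. ?h \<sigma> x * ?h \<tau> x) =
        1 / sqrt ((1 - 2 * (\<beta> / N) * card {..<N})\<^sup>2 - (2 * (\<beta> / N) * w \<sigma> \<tau>)\<^sup>2)"
      unfolding spin_factor_def w_def
      by (rule expectation_exp_square_signed_sum_pair[OF _ indep_vars_std_normal_column distributed_std_normal_column _ _ t])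
        (use spin_configs_signs[OF s(1)] spin_configs_signs[OF s(2)] in auto)
    also have "(1 - 2 * (\<beta> / N) * card {..<N})\<^sup>2 - (2 * (\<beta> / N) * w \<sigma> \<tau>)\<^sup>2 = (1 - 2 * \<beta>)\<^sup>2 * (1 - y)"
      using N \<beta> by (simp add: y_def a_def power_divide power_mult_distrib right_diff_distrib)
    also have "1 / sqrt \<dots> = ?c\<^sup>2 * (1 / sqrt (1 - y))"
      using \<beta> by (simp add: real_sqrt_mult power_divide)
    also have "\<dots> \<le> ?c\<^sup>2 * exp y"
      by (rule mult_left_mono[OF inverse_sqrt_one_minus_le_exp[OF y]]) simp
    finally show "expectation (\<lambda>x. ?h \<sigma> x * ?h \<tau> x) \<le> ?c\<^sup>2 * exp (a * (w \<sigma> \<tau>)\<^sup>2 / N\<^sup>2)"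
      unfolding y_def .
  qed
  show "integrable (PiM {..<p} (\<lambda>_. std_normal_column N)) (\<lambda>X. (Z {..<p} X)\<^sup>2)"
    by (rule integral_Z_square(1)[OF _ pair_int]) auto
  \<comment> \<open>After the p-th power, \<open>t'\<close> multiplies the squared inner product;
    the second bound on a says exactly that 2 t' N \<le> 1/2.\<close>
  define t' where "t' = p * a / N\<^sup>2"
  have "2 * t' * N \<le> 1 / 2"
    using a(2) N unfolding t'_def a_def[symmetric] by (simp add: field_simps power2_eq_square)
  then have t': "0 \<le> t'" "2 * t' * N < 1" and half: "1 / 2 \<le> 1 - 2 * t' * N" by (auto simp: t'_def a_def)
  have row: "(\<Sum>\<tau>\<in>?K. expectation (\<lambda>x. ?h \<sigma> x * ?h \<tau> x) ^ p) \<le> (?c\<^sup>2) ^ p * (2 * 2 ^ N)" if s: "\<sigma> \<in> ?K" for \<sigma>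
  proof -
    have "(\<Sum>\<tau>\<in>?K. expectation (\<lambda>x. ?h \<sigma> x * ?h \<tau> x) ^ p) \<le> (\<Sum>\<tau>\<in>?K. (?c\<^sup>2) ^ p * exp (t' * (w \<sigma> \<tau>)\<^sup>2))"
    proof (rule sum_mono)
      fix \<tau> assume "\<tau> \<in> ?K"
      then have "expectation (\<lambda>x. ?h \<sigma> x * ?h \<tau> x) ^ p \<le> (?c\<^sup>2 * exp (a * (w \<sigma> \<tau>)\<^sup>2 / N\<^sup>2)) ^ p"
        using pair[OF s] by (intro power_mono integral_nonneg_AE AE_I2) (auto simp: spin_factor_def)
      also have "\<dots> = (?c\<^sup>2) ^ p * exp (t' * (w \<sigma> \<tau>)\<^sup>2)"
        by (simp add: power_mult_distrib exp_of_nat_mult[symmetric] t'_def mult_ac)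
      finally show "expectation (\<lambda>x. ?h \<sigma> x * ?h \<tau> x) ^ p \<le> (?c\<^sup>2) ^ p * exp (t' * (w \<sigma> \<tau>)\<^sup>2)" .
    qed
    also have "\<dots> = (?c\<^sup>2) ^ p * (\<Sum>\<tau>\<in>?K. exp (t' * (w \<sigma> \<tau>)\<^sup>2))" by (simp add: sum_distrib_left)
    finally have le: "(\<Sum>\<tau>\<in>?K. expectation (\<lambda>x. ?h \<sigma> x * ?h \<tau> x) ^ p) \<le>
      (?c\<^sup>2) ^ p * (\<Sum>\<tau>\<in>?K. exp (t' * (w \<sigma> \<tau>)\<^sup>2))" .
    have "(\<Sum>\<tau>\<in>?K. exp (t' * (w \<sigma> \<tau>)\<^sup>2)) \<le> 2 ^ N / sqrt (1 - 2 * t' * N)"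
      unfolding w_def by (rule sum_spin_configs_exp_square_le[OF spin_configs_signs[OF s] t'])
    also have "\<dots> \<le> 2 ^ N / (1 / 2)"
    proof (intro divide_left_mono)
      show "1 / 2 \<le> sqrt (1 - 2 * t' * N)"
        using half by (intro real_le_rsqrt) (simp add: power2_eq_square)
    qed (use t' in auto)
    finally have "(\<Sum>\<tau>\<in>?K. exp (t' * (w \<sigma> \<tau>)\<^sup>2)) \<le> 2 * 2 ^ N" by simp
    from order_trans[OF le mult_left_mono[OF this]] show ?thesis by simp
  qed
  have "(\<integral>X. (Z {..<p} X)\<^sup>2 \<partial>PiM {..<p} (\<lambda>_. std_normal_column N)) =
      (\<Sum>\<sigma>\<in>?K. \<Sum>\<tau>\<in>?K. expectation (\<lambda>x. ?h \<sigma> x * ?h \<tau> x) ^ p) / (card ?K)\<^sup>2"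
    using integral_Z_square(2)[of "{..<p}", OF _ pair_int] by simp
  also have "\<dots> \<le> (\<Sum>\<sigma>\<in>?K. (?c\<^sup>2) ^ p * (2 * 2 ^ N)) / (card ?K)\<^sup>2"
    by (intro divide_right_mono sum_mono row) auto
  also have "\<dots> = 2 * (?c ^ p)\<^sup>2"
  proof -
    have "(?c\<^sup>2) ^ p = (?c ^ p)\<^sup>2" by (simp only: power_mult[symmetric] mult.commute)
    moreover have "2 ^ N * (x * (2 * 2 ^ N)) / (2 ^ N)\<^sup>2 = 2 * x" for x :: real
      by (simp add: power2_eq_square)
    ultimately show ?thesis by (simp add: card_spin_configs)
  qed
  finally show "(\<integral>X. (Z {..<p} X)\<^sup>2 \<partial>PiM {..<p} (\<lambda>_. std_normal_column N)) \<le> 2 * (?c ^ p)\<^sup>2" .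
qed

text \<open>An instance of \<open>ln_concentration\<close> with C = 2 from the second moment and V =
  2 c p from Efron--Stein, so the threshold 4 C V is 16 c p.\<close>

lemma spin_ln_concentration:
  fixes N p :: nat and \<beta> c t :: real
  assumes N: "0 < N" and \<beta>: "0 \<le> \<beta>" "4 * \<beta> < 1"
    and a: "(2 * \<beta> / (1 - 2 * \<beta>))\<^sup>2 \<le> 1 / 2" "(2 * \<beta> / (1 - 2 * \<beta>))\<^sup>2 * p \<le> N / 4"
    and c: "c = 1 / sqrt (1 - 2 * \<beta>)" and t: "0 < t" "16 * c * p < t\<^sup>2"
  shows "measure (PiM {..<p} (\<lambda>_. std_normal_column N))
      {X\<in>space (PiM {..<p} (\<lambda>_. std_normal_column N)).
        \<bar>ln (partition_function (spin_configs N) (spin_factor N \<beta>) {..<p} X) - p * ln c\<bar> > ln 2 + 2 * t}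
      \<le> 2 * c * p / t\<^sup>2"
proof -
  interpret factor_model "std_normal_column N" "spin_configs N" "spin_factor N \<beta>" c
    unfolding c by (rule factor_model_spin) (use N \<beta> in auto)
  interpret PP: prob_space "PiM {..<p} (\<lambda>_. std_normal_column N)"
    by (intro prob_space_PiM prob_space_axioms)
  have "0 < c" using \<beta> by (simp add: c)
  have E: "PP.expectation (Z {..<p}) = c ^ p" using integral_Z[of "{..<p}"] by simp
  then have "ln (PP.expectation (Z {..<p})) = p * ln c" using \<open>0 < c\<close> by (simp add: ln_realpow)
  moreover have "PP.expectation (\<lambda>X. (Z {..<p} X)\<^sup>2) \<le> 2 * (PP.expectation (Z {..<p}))\<^sup>2"
    unfolding E c by (rule spin_second_moment_le(2)[OF N \<beta> a])
  moreover have "PP.expectation (\<lambda>X. (ln (Z {..<p} X))\<^sup>2) - (PP.expectation (\<lambda>X. ln (Z {..<p} X)))\<^sup>2 \<le> 2 * c * p"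
    using variance_ln_Z_le[of "{..<p}"] by simp
  ultimately show ?thesis
    using PP.ln_concentration[of "Z {..<p}" 2 "2 * c * p" t] t
      integrable_Z[of "{..<p}"] Z_ge_1[of "{..<p}"] spin_second_moment_le(1)[OF N \<beta> a]
      integrable_ln_Z[of "{..<p}"] integrable_ln_Z_square[of "{..<p}"]
    by simp
qed

section \<open>From the product space to the given matrix\<close>

text \<open>Independence of all entries is grouped twice: into singletons to identify the law of a
  column, and into the disjoint blocks \<open>{..<N} \<times> {j}\<close> to make the columns
  independent. Positive dimensions keep the index sets nonempty, as the product-measure
  characterization of independence is applied to both.\<close>

lemma distr_columns:
  assumes "prob_space M" and iid: "iid_std_normal_matrix M N p X" and "0 < N" "0 < p"
  shows "(\<lambda>\<omega>. \<lambda>j\<in>{..<p}. \<lambda>i\<in>{..<N}. X i j \<omega>) \<in> M \<rightarrow>\<^sub>M PiM {..<p} (\<lambda>_. std_normal_column N)"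
    and "distr M (PiM {..<p} (\<lambda>_. std_normal_column N)) (\<lambda>\<omega>. \<lambda>j\<in>{..<p}. \<lambda>i\<in>{..<N}. X i j \<omega>) =
      PiM {..<p} (\<lambda>_. std_normal_column N)"
proof -
  interpret prob_space M by fact
  have ind: "indep_vars (\<lambda>_. borel) (\<lambda>(i, j). X i j) ({..<N} \<times> {..<p})"
    and D: "\<And>i j. i < N \<Longrightarrow> j < p \<Longrightarrow> distributed M lborel (X i j) std_normal_density"
    using iid by (auto simp: iid_std_normal_matrix_def)
  have m: "X i j \<in> borel_measurable M" if "i < N" "j < p" for i j
    using distributed_measurable[OF D[OF that]] by simp
  have dX: "distr M borel (X i j) = density lborel std_normal_density" if "i < N" "j < p" for i j
    using distributed_distr_eq_density[OF D[OF that]] by (metis distr_cong sets_lborel)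
  have mcol: "(\<lambda>\<omega>. \<lambda>i\<in>{..<N}. X i j \<omega>) \<in> M \<rightarrow>\<^sub>M std_normal_column N" if "j \<in> {..<p}" for j
    unfolding measurable_cong_sets[OF refl sets_std_normal_column]
    using that m by (intro measurable_restrict) auto
  show "(\<lambda>\<omega>. \<lambda>j\<in>{..<p}. \<lambda>i\<in>{..<N}. X i j \<omega>) \<in> M \<rightarrow>\<^sub>M PiM {..<p} (\<lambda>_. std_normal_column N)"
    by (rule measurable_restrict[OF mcol])
  have col: "distr M (std_normal_column N) (\<lambda>\<omega>. \<lambda>i\<in>{..<N}. X i j \<omega>) = std_normal_column N" if j: "j \<in> {..<p}" for j
  proof -
    have "indep_vars (\<lambda>i. PiM {(i, j)} (\<lambda>_. borel)) (\<lambda>i \<omega>. restrict (\<lambda>q. (case q of (i, j) \<Rightarrow> X i j) \<omega>) {(i, j)}) {..<N}"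
      by (rule indep_vars_restrict[OF ind]) (use j in \<open>auto simp: disjoint_family_on_def\<close>)
    then have "indep_vars (\<lambda>_. borel) (\<lambda>i \<omega>. restrict (\<lambda>q. (case q of (i, j) \<Rightarrow> X i j) \<omega>) {(i, j)} (i, j)) {..<N}"
      by (rule indep_vars_compose2[where Y="\<lambda>i y. y (i, j)"]) (auto intro!: measurable_component_singleton)
    then have "indep_vars (\<lambda>_. borel) (\<lambda>i. X i j) {..<N}" by simp
    then have "distr M (PiM {..<N} (\<lambda>_. borel)) (\<lambda>\<omega>. \<lambda>i\<in>{..<N}. X i j \<omega>) = PiM {..<N} (\<lambda>i. distr M borel (X i j))"
      using assms(3) m j by (subst (asm) indep_vars_iff_distr_eq_PiM') auto
    also have "\<dots> = std_normal_column N"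
      unfolding std_normal_column_def using dX j by (intro PiM_cong) auto
    finally show ?thesis
      by (subst distr_cong[OF refl sets_std_normal_column refl])
  qed
  have "indep_vars (\<lambda>j. PiM ({..<N} \<times> {j}) (\<lambda>_. borel)) (\<lambda>j \<omega>. restrict (\<lambda>q. (case q of (i, j) \<Rightarrow> X i j) \<omega>) ({..<N} \<times> {j})) {..<p}"
    by (rule indep_vars_restrict[OF ind]) (auto simp: disjoint_family_on_def)
  then have "indep_vars (\<lambda>_. std_normal_column N)
      (\<lambda>j \<omega>. (\<lambda>i\<in>{..<N}. restrict (\<lambda>q. (case q of (i, j) \<Rightarrow> X i j) \<omega>) ({..<N} \<times> {j}) (i, j))) {..<p}"
  proof (rule indep_vars_compose2[where Y="\<lambda>j y. \<lambda>i\<in>{..<N}. y (i, j)"])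
    show "(\<lambda>y. \<lambda>i\<in>{..<N}. y (i, j)) \<in> PiM ({..<N} \<times> {j}) (\<lambda>_. borel) \<rightarrow>\<^sub>M std_normal_column N" for j :: nat
      unfolding measurable_cong_sets[OF refl sets_std_normal_column]
      by (intro measurable_restrict measurable_component_singleton) auto
  qed
  also have "(\<lambda>j \<omega>. (\<lambda>i\<in>{..<N}. restrict (\<lambda>q. (case q of (i, j) \<Rightarrow> X i j) \<omega>) ({..<N} \<times> {j}) (i, j))) =
      (\<lambda>j \<omega>. \<lambda>i\<in>{..<N}. X i j \<omega>)"
    by (intro ext) (auto simp: restrict_def)
  finally have "distr M (PiM {..<p} (\<lambda>_. std_normal_column N)) (\<lambda>\<omega>. \<lambda>j\<in>{..<p}. \<lambda>i\<in>{..<N}. X i j \<omega>) =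
      PiM {..<p} (\<lambda>j. distr M (std_normal_column N) (\<lambda>\<omega>. \<lambda>i\<in>{..<N}. X i j \<omega>))"
    using assms(4) mcol by (subst (asm) indep_vars_iff_distr_eq_PiM') auto
  also have "\<dots> = PiM {..<p} (\<lambda>_. std_normal_column N)"
    using col by (intro PiM_cong) auto
  finally show "distr M (PiM {..<p} (\<lambda>_. std_normal_column N)) (\<lambda>\<omega>. \<lambda>j\<in>{..<p}. \<lambda>i\<in>{..<N}. X i j \<omega>) =
      PiM {..<p} (\<lambda>_. std_normal_column N)" .
qed

text \<open>Since J is a Gram matrix, its form is the squared length of X^T \<sigma> over N; this is
  what makes the weight factor over columns.\<close>

lemma quadratic_form_coupling_matrix:
  "quadratic_form N (coupling_matrix N p A) \<sigma> = (\<Sum>j<p. (\<Sum>i<N. \<sigma> i * A i j)\<^sup>2) / N"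
proof -
  have "quadratic_form N (coupling_matrix N p A) \<sigma> =
      (\<Sum>i<N. \<Sum>k<N. \<Sum>j<p. (\<sigma> i * A i j) * (\<sigma> k * A k j)) / N"
    unfolding quadratic_form_def coupling_matrix_def
    by (simp add: sum_distrib_left sum_distrib_right sum_divide_distrib mult_ac)
  also have "(\<Sum>i<N. \<Sum>k<N. \<Sum>j<p. (\<sigma> i * A i j) * (\<sigma> k * A k j)) =
      (\<Sum>i<N. \<Sum>j<p. \<Sum>k<N. (\<sigma> i * A i j) * (\<sigma> k * A k j))"
    by (intro sum.cong refl sum.swap)
  also have "\<dots> = (\<Sum>j<p. \<Sum>i<N. \<Sum>k<N. (\<sigma> i * A i j) * (\<sigma> k * A k j))"
    by (rule sum.swap)
  also have "\<dots> = (\<Sum>j<p. (\<Sum>i<N. \<sigma> i * A i j)\<^sup>2)"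
    by (simp add: power2_eq_square sum_product)
  finally show ?thesis .
qed

lemma free_energy_eq_ln_partition_function:
  "free_energy N \<beta> (coupling_matrix N p A) =
    ln (partition_function (spin_configs N) (spin_factor N \<beta>) {..<p} (\<lambda>j\<in>{..<p}. \<lambda>i\<in>{..<N}. A i j)) / N"
proof -
  have "exp (\<beta> * quadratic_form N (coupling_matrix N p A) \<sigma>) =
      (\<Prod>j<p. spin_factor N \<beta> \<sigma> ((\<lambda>j\<in>{..<p}. \<lambda>i\<in>{..<N}. A i j) j))" for \<sigma>
    unfolding quadratic_form_coupling_matrix spin_factor_def
    by (simp add: exp_sum[symmetric] sum_distrib_left sum_divide_distrib)
  then show ?thesis
    by (simp add: free_energy_def partition_function_def card_spin_configs)
qed

lemma free_energy_deviation:
  fixes N p :: nat and \<beta> c t :: real and F :: "'a \<Rightarrow> real"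
  assumes "prob_space M" and iid: "iid_std_normal_matrix M N p X" and N: "0 < N" "0 < p"
    and \<beta>: "0 \<le> \<beta>" "4 * \<beta> < 1"
    and a: "(2 * \<beta> / (1 - 2 * \<beta>))\<^sup>2 \<le> 1 / 2" "(2 * \<beta> / (1 - 2 * \<beta>))\<^sup>2 * p \<le> N / 4"
    and c: "c = 1 / sqrt (1 - 2 * \<beta>)" and t: "0 < t" "16 * c * p < t\<^sup>2"
  defines "F \<equiv> \<lambda>\<omega>. free_energy N \<beta> (coupling_matrix N p (\<lambda>i j. X i j \<omega>))"
  shows "F \<in> borel_measurable M"
    and "measure M {\<omega>\<in>space M. \<bar>N * F \<omega> - p * ln c\<bar> > ln 2 + 2 * t} \<le> 2 * c * p / t\<^sup>2"
proof -
  interpret factor_model "std_normal_column N" "spin_configs N" "spin_factor N \<beta>" c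
    unfolding c by (rule factor_model_spin) (use N \<beta> in auto)
  let ?P = "PiM {..<p} (\<lambda>_. std_normal_column N)"
  define T where "T = (\<lambda>\<omega>. \<lambda>j\<in>{..<p}. \<lambda>i\<in>{..<N}. X i j \<omega>)"
  have T[measurable]: "T \<in> M \<rightarrow>\<^sub>M ?P" and distr: "distr M ?P T = ?P"
    unfolding T_def using distr_columns[OF assms(1) iid N] by auto
  have F: "F \<omega> = ln (Z {..<p} (T \<omega>)) / N" for \<omega>
    unfolding F_def T_def by (rule free_energy_eq_ln_partition_function)
  show "F \<in> borel_measurable M"
    unfolding F
    by (intro borel_measurable_divide borel_measurable_ln measurable_compose[OF T measurable_Z]
        borel_measurable_const) simp
  have [measurable]: "Z {..<p} \<in> borel_measurable ?P"
    by (rule measurable_Z) simp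
  let ?B = "{X\<in>space ?P. \<bar>ln (Z {..<p} X) - p * ln c\<bar> > ln 2 + 2 * t}"
  have B: "{\<omega>\<in>space M. \<bar>N * F \<omega> - p * ln c\<bar> > ln 2 + 2 * t} = T -` ?B \<inter> space M"
    using N(1) measurable_space[OF T] by (auto simp: F)
  have "measure M (T -` ?B \<inter> space M) = measure (distr M ?P T) ?B"
    by (rule measure_distr[symmetric]) measurable
  also have "\<dots> \<le> 2 * c * p / t\<^sup>2"
    unfolding distr by (rule spin_ln_concentration[OF N(1) \<beta> a c t])
  finally show "measure M {\<omega>\<in>space M. \<bar>N * F \<omega> - p * ln c\<bar> > ln 2 + 2 * t} \<le> 2 * c * p / t\<^sup>2"
    unfolding B .
qed

theorem proposition2p4:
  fixes p :: "nat \<Rightarrow> nat" and c1 c2 lam :: real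
    and M :: "nat \<Rightarrow> 'a measure" and X :: "nat \<Rightarrow> nat \<Rightarrow> nat \<Rightarrow> 'a \<Rightarrow> real"
  assumes "\<And>N. N \<ge> 1 \<Longrightarrow> p N > 0"
    and "0 < c1" and "c2 < 1"
    and "\<And>N. N \<ge> 1 \<Longrightarrow> c1 < real N / real (p N) \<and> real N / real (p N) < c2"
    and "lam > 1"
    and "(\<lambda>N. real (p N) / real N) \<longlonglongrightarrow> lam"
    and "\<And>N. N \<ge> 1 \<Longrightarrow> prob_space (M N)"
    and "\<And>N. N \<ge> 1 \<Longrightarrow> iid_std_normal_matrix (M N) N (p N) (X N)"
  shows "\<exists>\<beta>\<^sub>0>0. \<forall>\<beta>. 0 < \<beta> \<and> \<beta> < \<beta>\<^sub>0 \<longrightarrow>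
    converges_in_probability M
      (\<lambda>N \<omega>. free_energy N \<beta> (coupling_matrix N (p N) (\<lambda>i j. X N i j \<omega>)))
      (lam / 2 * ln (1 / (1 - 2 * \<beta>)))"
proof (intro exI[of _ "sqrt c1 / 8"] conjI allI impI)
  \<comment> \<open>The threshold is chosen so that 2\<beta> / (1 - 2\<beta>) \<le> 4\<beta> \<le>
    sqrt c1 / 2. Then a \<le> c1 / 4, and c1 p \<le> N yields the required a p \<le> N / 4.\<close>
  show "0 < sqrt c1 / 8" using assms(2) by simp
  fix \<beta> :: real assume \<beta>: "0 < \<beta> \<and> \<beta> < sqrt c1 / 8"
  have c1: "c1 < 1" using assms(3) assms(4)[of 1] by linarith
  then have "sqrt c1 < 1" by simp
  then have \<beta>8: "8 * \<beta> < 1" using \<beta> by linarith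
  define a where "a = (2 * \<beta> / (1 - 2 * \<beta>))\<^sup>2"
  have "2 * \<beta> / (1 - 2 * \<beta>) \<le> 4 * \<beta>"
    using \<beta> \<beta>8 by (simp add: field_simps)
  also have "4 * \<beta> \<le> sqrt c1 / 2" using \<beta> by simp
  finally have "a \<le> (sqrt c1 / 2)\<^sup>2"
    unfolding a_def using \<beta> \<beta>8 by (intro power_mono) auto
  then have a: "a \<le> c1 / 4" using assms(2) by (simp add: power_divide)
  define c where "c = 1 / sqrt (1 - 2 * \<beta>)"
  have "1 \<le> c" using \<beta> \<beta>8 by (simp add: c_def)
  define L where "L = lam / 2 * ln (1 / (1 - 2 * \<beta>))"
  \<comment> \<open>ln c = -ln(1 - 2\<beta>) / 2 is the contribution per column, and there are about
    \<lambda> N columns.\<close>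
  have L: "L = lam * ln c"
    using \<beta> \<beta>8 by (simp add: L_def c_def ln_div ln_sqrt)
  define F where "F N \<omega> = free_energy N \<beta> (coupling_matrix N (p N) (\<lambda>i j. X N i j \<omega>))" for N \<omega>
  have p_le: "c1 * p N \<le> N" if "1 \<le> N" for N
    using assms(1)[OF that] assms(4)[OF that] by (simp add: field_simps)
  have a2: "a * p N \<le> N / 4" if "1 \<le> N" for N
    using mult_right_mono[OF a, of "p N"] p_le[OF that] by simp
  have meas: "F N \<in> borel_measurable (M N)"
    and dev: "\<And>t. 0 < t \<Longrightarrow> 16 * c * p N < t\<^sup>2 \<Longrightarrow>
      measure (M N) {\<omega>\<in>space (M N). \<bar>N * F N \<omega> - p N * ln c\<bar> > ln 2 + 2 * t} \<le> 2 * c * p N / t\<^sup>2"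
    if "1 \<le> N" for N
  proof -
    have "a \<le> 1 / 2" using a c1 by simp
    then have *: "(2 * \<beta> / (1 - 2 * \<beta>))\<^sup>2 \<le> 1 / 2" "(2 * \<beta> / (1 - 2 * \<beta>))\<^sup>2 * p N \<le> N / 4"
      using a2[OF that] by (auto simp: a_def)
    have N: "0 < N" "0 < p N" "0 \<le> \<beta>" "4 * \<beta> < 1" using that assms(1) \<beta> \<beta>8 by auto
    note fed = free_energy_deviation[OF assms(7)[OF that] assms(8)[OF that] N * c_def]
    \<comment> \<open>An admissible \<open>t\<close> for the measurability claim, from x < (1 + x)^2
      for x \<ge> 0.\<close>
    have "16 * c * p N < (1 + 16 * c * p N)\<^sup>2"
      using \<open>1 \<le> c\<close> by (simp add: power2_eq_square algebra_simps add_pos_nonneg)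
    then show "F N \<in> borel_measurable (M N)"
      unfolding F_def[abs_def] using \<open>1 \<le> c\<close> by (intro fed(1)[of "1 + 16 * c * p N"]) (auto simp: add_pos_nonneg)
    show "measure (M N) {\<omega>\<in>space (M N). \<bar>N * F N \<omega> - p N * ln c\<bar> > ln 2 + 2 * t} \<le> 2 * c * p N / t\<^sup>2"
      if "0 < t" "16 * c * p N < t\<^sup>2" for t
      unfolding F_def using fed(2)[OF that] .
  qed
  show "converges_in_probability M
      (\<lambda>N \<omega>. free_energy N \<beta> (coupling_matrix N (p N) (\<lambda>i j. X N i j \<omega>)))
      (lam / 2 * ln (1 / (1 - 2 * \<beta>)))"
    unfolding converges_in_probability_def F_def[symmetric] L_def[symmetric]
  proof (intro conjI allI impI)
    show "\<forall>\<^sub>F N in sequentially. F N \<in> borel_measurable (M N)"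
      using eventually_ge_at_top[of 1] by eventually_elim (rule meas)
    fix \<epsilon> :: real assume \<epsilon>: "\<epsilon> > 0"
    \<comment> \<open>With t = N \<epsilon> / 8 and p \<le> N / c1, the deviation bound 2 c p / t^2
      is at most D / N.\<close>
    define D where "D = 128 * c / (c1 * \<epsilon>\<^sup>2)"
    have "(\<lambda>N. real (p N) / N * ln c) \<longlonglongrightarrow> L"
      unfolding L by (intro tendsto_intros assms(6))
    then have ev1: "\<forall>\<^sub>F N in sequentially. \<bar>real (p N) / N * ln c - L\<bar> < \<epsilon> / 2"
      using \<epsilon> by (auto dest!: tendstoD[where e="\<epsilon> / 2"] simp: dist_real_def)
    \<comment> \<open>\<open>ev2\<close> gives ln 2 < N \<epsilon> / 4, which with 2t = N \<epsilon>
      / 4 stays below N \<epsilon> / 2; the other half of \<epsilon> pays for replacing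
      \<open>L\<close> by its finite-N version in \<open>ev1\<close>. \<open>ev3\<close> gives D / N
      < 1/8, equivalent to the threshold 16 c p < t^2 once D / N bounds 2 c p / t^2.\<close>
    have ev2: "\<forall>\<^sub>F N in sequentially. 4 * ln 2 / \<epsilon> < real N"
      and ev3: "\<forall>\<^sub>F N in sequentially. 8 * D < real N"
      using filterlim_at_top_dense[THEN iffD1, OF filterlim_real_sequentially] by blast+
    have bound: "\<forall>\<^sub>F N in sequentially. measure (M N) {\<omega>\<in>space (M N). \<bar>F N \<omega> - L\<bar> > \<epsilon>} \<le> D / N"
      using ev1 ev2 ev3 eventually_ge_at_top[of 1]
    proof eventually_elim
      case (elim N)
      interpret prob_space "M N" by (rule assms(7)[OF elim(4)])
      note [measurable] = meas[OF elim(4)]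
      have N: "0 < real N" using elim(4) by simp
      define t where "t = N * \<epsilon> / 8"
      have t: "0 < t" using N \<epsilon> by (simp add: t_def)
      have t2: "t\<^sup>2 = N * (N * \<epsilon>\<^sup>2 / 64)" by (simp add: t_def power2_eq_square)
      have "2 * c * p N / t\<^sup>2 \<le> 2 * c * (N / c1) / t\<^sup>2"
        using p_le[OF elim(4)] assms(2) \<open>1 \<le> c\<close>
        by (intro divide_right_mono mult_left_mono) (auto simp: field_simps)
      also have "\<dots> = D / N"
        unfolding t2 D_def using N \<epsilon> assms(2) by (simp add: field_simps)
      finally have le: "2 * c * p N / t\<^sup>2 \<le> D / N" .
      also have "\<dots> < 1 / 8" using elim(3) N by (simp add: field_simps)
      finally have t16: "16 * c * p N < t\<^sup>2" using t by (simp add: field_simps)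
      have "{\<omega>\<in>space (M N). \<bar>F N \<omega> - L\<bar> > \<epsilon>} \<subseteq>
          {\<omega>\<in>space (M N). \<bar>N * F N \<omega> - p N * ln c\<bar> > ln 2 + 2 * t}"
      proof safe
        fix \<omega> assume "\<bar>F N \<omega> - L\<bar> > \<epsilon>"
        moreover have "\<epsilon> / 2 < \<bar>x - q\<bar>" if "\<epsilon> < \<bar>x - L\<bar>" "\<bar>q - L\<bar> < \<epsilon> / 2" for x q
          using that by linarith
        ultimately have "\<epsilon> / 2 < \<bar>F N \<omega> - real (p N) / N * ln c\<bar>" using elim(1) by blast
        then have "N * (\<epsilon> / 2) < N * \<bar>F N \<omega> - real (p N) / N * ln c\<bar>" using N by (intro mult_strict_left_mono)
        also have "\<dots> = \<bar>N * (F N \<omega> - real (p N) / N * ln c)\<bar>" using N by (simp add: abs_mult)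
        also have "N * (F N \<omega> - real (p N) / N * ln c) = N * F N \<omega> - p N * ln c"
          using N by (simp add: right_diff_distrib)
        finally show "ln 2 + 2 * t < \<bar>N * F N \<omega> - p N * ln c\<bar>"
          using elim(2) \<epsilon> by (simp add: t_def field_simps)
      qed
      then have "prob {\<omega>\<in>space (M N). \<bar>F N \<omega> - L\<bar> > \<epsilon>} \<le>
          prob {\<omega>\<in>space (M N). \<bar>N * F N \<omega> - p N * ln c\<bar> > ln 2 + 2 * t}"
        by (intro finite_measure_mono) measurable
      also have "\<dots> \<le> D / N" using dev[OF elim(4) t t16] le by linarith
      finally show ?case .
    qed
    show "(\<lambda>N. measure (M N) {\<omega>\<in>space (M N). \<bar>F N \<omega> - L\<bar> > \<epsilon>}) \<longlonglongrightarrow> 0"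
      by (rule tendsto_sandwich[OF _ bound tendsto_const lim_const_over_n]) simp
  qed
qed

end
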